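(* Let $(\mathbb{L},\mu)$ be a random iterated function system of contracting similarities on $\mathbb{R}^d$ satisfying the uniform open set condition, with $2\le\sup_\lambda\mathcal{N}_\lambda<\infty$ and $\mathbb{E}(\log\mathcal{N}_{\omega_1})>0$, and suppose that for every $\lambda\in\Lambda$ there is $c_\lambda\in[c_{\min},c_{\max}]$ with $c_\lambda^i=c_\lambda$ for every $1\le i\le\mathcal{N}_\lambda$, where $0<c_{\min}\le c_{\max}<1$. Assume $(\mathbb{L},\mu)$ is not almost deterministic. Let $F_\omega$ be the associated random homogeneous attractor and let $s$ be the almost sure value of $\dim_H F_\omega$. Let $\varepsilon>0$. Then there exists a real number $\eta>0$ such that, with $\beta=\operatorname{Var}(\log\mathfrak{S}_{\omega_1}^s)/\eta$, \[ \mathscr{H}^{h_1(t,\beta,\varepsilon)}(F_\omega)=0 \] almost surely.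
   Context: **Random iterated function system (RIFS).** $\Lambda\subset\mathbb{R}^k$ is a non-empty compact set with a Borel probability measure $\mu$. For each $\lambda\in\Lambda$, $\mathbb{I}_\lambda=\{f_\lambda^1,\dots,f_\lambda^{\mathcal{N}_\lambda}\}$, $\mathcal{N}_\lambda\in\mathbb{N}$, $\mathcal{N}_\lambda\ge1$, is a finite family of maps of $\mathbb{R}^d$ with $|f_\lambda^i(x)-f_\lambda^i(y)|=c_\lambda^i|x-y|$, $c_\lambda^i\in(0,1)$. Put $\mathbb{L}=\{\mathbb{I}_\lambda\}_{\lambda\in\Lambda}$; the pair $(\mathbb{L},\mu)$ is the RIFS. The dependence on $\lambda$ is understood to be measurable, and there is a compact $\Delta\subset\mathbb{R}^d$ with $f_\lambda^i(\Delta)\subseteq\Delta$ for all $\lambda,i$. **UOSC.** There is a non-empty bounded open set $\mathcal{O}\subset\mathbb{R}^d$ with $f_\lambda^i(\mathcal{O})\subseteq\mathcal{O}$ and $f_\lambda^i(\mathcal{O})\cap f_\lambda^j(\mathcal{O})=\varnothing$ for all $\lambda\in\Lambda$, $1\le i\neq j\le\mathcal{N}_\lambda$. **Random homogeneous attractor.** $\Omega=\Lambda^{\mathbb{N}}$ with the product measure $\mathbb{P}_H=\mu^{\mathbb{N}}$; "almost surely", $\mathbb{E}$ and $\operatorname{Var}$ refer to $\mathbb{P}_H$. For $\omega=\omega_1\omega_2\cdots\in\Omega$, \[F_\omega=\bigcap_{k=1}^\infty\ \bigcup_{1\le j_i\le\mathcal{N}_{\omega_i},\,1\le i\le k} f_{\omega_1}^{j_1}\circ\cdots\circ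 f_{\omega_k}^{j_k}(\Delta).\] **Notation.** $\mathfrak{S}_\lambda^s=\sum_{j=1}^{\mathcal{N}_\lambda}(c_\lambda^j)^s$. Under these assumptions it is known that $\dim_H F_\omega$ is almost surely the unique $s$ with $\mathbb{E}(\log\mathfrak{S}_{\omega_1}^s)=0$. The RIFS is *almost deterministic* if there is $s$ with $\mathfrak{S}_\lambda^s=1$ for $\mu$-almost every $\lambda$. **Gauge function.** For $\beta>0$, $\gamma\in\mathbb{R}$ and small $t>0$, \[h_1(t,\beta,\gamma)=t^s\Big(\exp\sqrt{2\beta\,(\log(1/t))\,(\log\log\log(1/t^\beta))}\Big)^{1-\gamma},\] where $\log\log\log(1/t^\beta)=\log\log(\beta\log(1/t))$. A function given by such a formula is used as a gauge function on an interval $(0,r_0]$ on which it is defined and non-decreasing, and is extended by the constant value at $r_0$ for $t>r_0$ (and $0$ at $0$). $\mathscr{H}^h(F)=\lim_{\delta\to0}\inf\{\sum_i h(|U_i|) : \{U_i\}$ a countable cover of $F$ by sets of diameter $|U_i|\le\delta\}$. *)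

theory Defs
  imports "HOL-Probability.Probability"
begin

section \<open>Hausdorff measures and Hausdorff dimension\<close>

text \<open>
  Gauge functions are real functions that are nonnegative on \<open>[0,\<infinity>)\<close> and vanish at \<open>0\<close>.
  Countable covers are sequences of sets; since the gauge vanishes at \<open>0\<close> and
  \<^term>\<open>diameter {} = 0\<close>, finite covers are included by padding with empty sets.
  Boundedness is required because \<^const>\<open>diameter\<close> is meaningful for bounded sets only.
\<close>

definition hausdorff_premeasure :: "(real \<Rightarrow> real) \<Rightarrow> 'a::metric_space set \<Rightarrow> real \<Rightarrow> ennreal" where
  "hausdorff_premeasure h F \<delta> =
     Inf {(\<Sum>i. ennreal (h (diameter (U i)))) | U :: nat \<Rightarrow> 'a set.
            F \<subseteq> (\<Union>i. U i) \<and> (\<forall>i. bounded (U i) \<and> diameter (U i) \<le> \<delta>)}"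

definition hausdorff_measure :: "(real \<Rightarrow> real) \<Rightarrow> 'a::metric_space set \<Rightarrow> ennreal" where
  "hausdorff_measure h F = Lim (at_right 0) (hausdorff_premeasure h F)"

lemma hausdorff_premeasure_antimono:
  "\<delta> \<le> \<delta>' \<Longrightarrow> hausdorff_premeasure h F \<delta>' \<le> hausdorff_premeasure h F \<delta>"
  unfolding hausdorff_premeasure_def by (rule Inf_superset_mono) (use order_trans in blast)

lemma hausdorff_premeasure_tendsto_SUP:
  "(hausdorff_premeasure h F \<longlongrightarrow> (SUP \<delta>\<in>{0<..}. hausdorff_premeasure h F \<delta>)) (at_right 0)"
proof (rule order_tendstoI)
  fix a assume "a < (SUP \<delta>\<in>{0<..}. hausdorff_premeasure h F \<delta>)"
  then obtain d where d: "d > 0" "a < hausdorff_premeasure h F d"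
    by (auto simp: less_SUP_iff)
  have "\<forall>\<^sub>F x in at_right 0. x < d"
    using d(1) by (auto simp: eventually_at_right_field)
  then show "\<forall>\<^sub>F x in at_right 0. a < hausdorff_premeasure h F x"
    by (rule eventually_mono)
      (use d(2) hausdorff_premeasure_antimono less_le_trans less_imp_le in blast)
next
  fix a assume a: "(SUP \<delta>\<in>{0<..}. hausdorff_premeasure h F \<delta>) < a"
  show "\<forall>\<^sub>F x in at_right 0. hausdorff_premeasure h F x < a"
    using eventually_at_right_less[of "0::real"]
    by (rule eventually_mono) (rule le_less_trans[OF SUP_upper a], simp)
qed

lemma hausdorff_measure_eq_SUP:
  "hausdorff_measure h F = (SUP \<delta>\<in>{0<..}. hausdorff_premeasure h F \<delta>)"
  unfolding hausdorff_measure_def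
  by (rule tendsto_Lim[OF _ hausdorff_premeasure_tendsto_SUP]) simp

text \<open>
  Restricted to Euclidean spaces, where the set below is nonempty, so that the real infimum is
  the Hausdorff dimension.  For \<open>s = 0\<close> the gauge is \<open>0\<close> at \<open>0\<close> (and \<open>1\<close> elsewhere), which
  may put \<open>0\<close> into the set for countable \<open>F\<close> but does not change the infimum.
\<close>

definition hausdorff_dim :: "'a::euclidean_space set \<Rightarrow> real" where
  "hausdorff_dim F = Inf {s. 0 \<le> s \<and> hausdorff_measure (\<lambda>t. t powr s) F = 0}"


section \<open>Random iterated function systems\<close>

text \<open>
  The maps \<open>f \<lambda> 1, \<dots>, f \<lambda> (N \<lambda>)\<close> form the iterated function system with parameter \<open>\<lambda>\<close>;
  the values \<open>f \<lambda> i\<close> and \<open>c \<lambda> i\<close> for other \<open>i\<close> are irrelevant.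
\<close>

locale rifs = prob_space \<mu>
  for \<mu> :: "(real ^ 'k) measure"
    and \<Lambda> :: "(real ^ 'k) set"
    and N :: "real ^ 'k \<Rightarrow> nat"
    and f :: "real ^ 'k \<Rightarrow> nat \<Rightarrow> real ^ 'd \<Rightarrow> real ^ 'd"
    and c :: "real ^ 'k \<Rightarrow> nat \<Rightarrow> real"
    and \<Delta> :: "(real ^ 'd) set" +
  assumes Lambda: "compact \<Lambda>" "\<Lambda> \<noteq> {}"
    and space_mu: "space \<mu> = \<Lambda>"
    and sets_mu: "sets \<mu> = sets (restrict_space borel \<Lambda>)"
    and N_ge_1: "\<And>l. l \<in> \<Lambda> \<Longrightarrow> 1 \<le> N l"
    and ratio: "\<And>l i. l \<in> \<Lambda> \<Longrightarrow> i \<in> {1..N l} \<Longrightarrow> c l i \<in> {0<..<1}"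
    and similarity: "\<And>l i x y. l \<in> \<Lambda> \<Longrightarrow> i \<in> {1..N l} \<Longrightarrow>
          norm (f l i x - f l i y) = c l i * norm (x - y)"
    and N_measurable: "N \<in> measurable \<mu> (count_space UNIV)"
    and f_measurable: "\<And>i x. 1 \<le> i \<Longrightarrow>
          (\<lambda>l. f l i x) \<in> borel_measurable (restrict_space \<mu> {l \<in> \<Lambda>. i \<le> N l})"
    and Delta: "compact \<Delta>" "\<Delta> \<noteq> {}"
    and Delta_invariant: "\<And>l i. l \<in> \<Lambda> \<Longrightarrow> i \<in> {1..N l} \<Longrightarrow> f l i ` \<Delta> \<subseteq> \<Delta>"

definition UOSC :: "('l set) \<Rightarrow> ('l \<Rightarrow> nat) \<Rightarrow> ('l \<Rightarrow> nat \<Rightarrow> real ^ 'd \<Rightarrow> real ^ 'd) \<Rightarrow> bool" where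
  "UOSC \<Lambda> N f \<longleftrightarrow> (\<exists>O'. O' \<noteq> {} \<and> bounded O' \<and> open O' \<and>
     (\<forall>l\<in>\<Lambda>. \<forall>i\<in>{1..N l}. f l i ` O' \<subseteq> O') \<and>
     (\<forall>l\<in>\<Lambda>. \<forall>i\<in>{1..N l}. \<forall>j\<in>{1..N l}. i \<noteq> j \<longrightarrow> f l i ` O' \<inter> f l j ` O' = {}))"

text \<open>
  Sequences \<open>\<omega>\<^sub>1\<omega>\<^sub>2\<dots>\<close> of parameters are indexed from \<open>0\<close>: the entry \<open>\<omega>\<^sub>i\<^sub>+\<^sub>1\<close> is \<open>\<omega> i\<close>.
\<close>

definition PH :: "'l measure \<Rightarrow> (nat \<Rightarrow> 'l) measure" where
  "PH \<mu> = (\<Pi>\<^sub>M i\<in>UNIV. \<mu>)"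

text \<open>\<open>cyl_map f \<omega> j k\<close> is the composition of the first \<open>k\<close> maps chosen by \<open>j\<close>, the first one outermost.\<close>

primrec cyl_map :: "('l \<Rightarrow> nat \<Rightarrow> 'x \<Rightarrow> 'x) \<Rightarrow> (nat \<Rightarrow> 'l) \<Rightarrow> (nat \<Rightarrow> nat) \<Rightarrow> nat \<Rightarrow> 'x \<Rightarrow> 'x" where
  "cyl_map f \<omega> j 0 = id"
| "cyl_map f \<omega> j (Suc k) = cyl_map f \<omega> j k \<circ> f (\<omega> k) (j k)"

definition attractor ::
  "('l \<Rightarrow> nat) \<Rightarrow> ('l \<Rightarrow> nat \<Rightarrow> 'x \<Rightarrow> 'x) \<Rightarrow> 'x set \<Rightarrow> (nat \<Rightarrow> 'l) \<Rightarrow> 'x set" where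
  "attractor N f \<Delta> \<omega> =
     (\<Inter>k\<in>{1..}. \<Union>j\<in>{j. \<forall>i<k. j i \<in> {1..N (\<omega> i)}}. cyl_map f \<omega> j k ` \<Delta>)"

definition ratio_sum :: "('l \<Rightarrow> nat) \<Rightarrow> ('l \<Rightarrow> nat \<Rightarrow> real) \<Rightarrow> 'l \<Rightarrow> real \<Rightarrow> real" where
  "ratio_sum N c l s = (\<Sum>j\<in>{1..N l}. c l j powr s)"

definition almost_deterministic ::
  "'l measure \<Rightarrow> ('l \<Rightarrow> nat) \<Rightarrow> ('l \<Rightarrow> nat \<Rightarrow> real) \<Rightarrow> bool" where
  "almost_deterministic \<mu> N c \<longleftrightarrow> (\<exists>s. AE l in \<mu>. ratio_sum N c l s = 1)"


section \<open>The gauge function\<close>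

definition h1 :: "real \<Rightarrow> real \<Rightarrow> real \<Rightarrow> real \<Rightarrow> real" where
  "h1 s t \<beta> \<gamma> =
     t powr s * exp (sqrt (2 * \<beta> * ln (1 / t) * ln (ln (ln (1 / t powr \<beta>))))) powr (1 - \<gamma>)"

text \<open>
  Since \<^const>\<open>ln\<close> and \<^const>\<open>sqrt\<close> are total, the domain of the formula has to be spelled out.
\<close>

definition h1_defined :: "real \<Rightarrow> real \<Rightarrow> bool" where
  "h1_defined t \<beta> \<longleftrightarrow> 0 < t \<and> 0 < ln (1 / t powr \<beta>) \<and> 0 < ln (ln (1 / t powr \<beta>)) \<and>
     0 \<le> 2 * \<beta> * ln (1 / t) * ln (ln (ln (1 / t powr \<beta>)))"

definition h1_admissible :: "real \<Rightarrow> real \<Rightarrow> real \<Rightarrow> real \<Rightarrow> bool" where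
  "h1_admissible s \<beta> \<gamma> r0 \<longleftrightarrow> 0 < r0 \<and> (\<forall>t\<in>{0<..r0}. h1_defined t \<beta>) \<and>
     mono_on {0<..r0} (\<lambda>t. h1 s t \<beta> \<gamma>)"

definition h1_gauge :: "real \<Rightarrow> real \<Rightarrow> real \<Rightarrow> real \<Rightarrow> real \<Rightarrow> real" where
  "h1_gauge s \<beta> \<gamma> r0 t =
     (if t \<le> 0 then 0 else if t \<le> r0 then h1 s t \<beta> \<gamma> else h1 s r0 \<beta> \<gamma>)"

end

theory Submission
  imports Defs "HOL-Real_Asymp.Real_Asymp"
begin

text \<open>
  Let \<open>P\<^sub>k\<close> be the number and \<open>R\<^sub>k\<close> the common ratio of the cylinders of level \<open>k\<close>.  Covering by these
  cylinders shows that \<open>H\<^sup>h(F) = 0\<close> as soon as \<open>liminf P\<^sub>k h(D R\<^sub>k) = 0\<close>, where \<open>D\<close> bounds the diameter of \<open>\<Delta>\<close>.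
  Now \<open>ln (P\<^sub>k R\<^sub>k\<^sup>s)\<close> is a random walk with bounded i.i.d. steps, and it is centred when \<open>s\<close> is the
  dimension: a packing argument based on the open set condition shows that the dimension is the zero
  of the pressure.  Since \<open>\<eta>\<close> may be chosen large, \<open>\<beta>\<close> is as small as we please, and a lower law of the
  iterated logarithm with an arbitrary positive constant suffices: the walk is below
  \<open>- \<delta> sqrt (k ln (ln k))\<close> infinitely often, which beats the correction factor of the gauge.

  For that law, the walk is observed along super-exponentially growing times.  Between two of them
  lie about \<open>ln n\<close> blocks of equal length \<open>b\<close>; by the central limit theorem each of them contributes at
  most \<open>- \<sigma> sqrt b\<close> with probability at least \<open>p\<close>, hence all of them do with probability of order \<open>1 / n\<close>,
  and the second Borel-Cantelli lemma applies.
\<close>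

section \<open>Sums of bounded i.i.d. random variables\<close>

text \<open>By independence and 1 - p \<le> exp (- p), the probability of \<open>Z\<close>, that no
  event from index \<open>m\<close> on occurs, is at most the exponential of minus any partial sum
  of the probabilities. If \<open>prob Z\<close> were positive, these sums would be bounded by
  \<open>- ln (prob Z)\<close>, against divergence.\<close>

lemma (in prob_space) borel_cantelli_2:
  fixes P :: "nat \<Rightarrow> 'a \<Rightarrow> bool"
  assumes indep: "indep_vars (\<lambda>_. count_space UNIV) P UNIV"
    and div: "\<not> summable (\<lambda>n. prob {x \<in> space M. P n x})"
  shows "AE x in M. \<exists>\<^sub>F n in sequentially. P n x"
proof -
  have Pm[measurable]: "P n \<in> measurable M (count_space UNIV)" for n
    using indep by (auto simp: indep_vars_def)
  define p where "p n = prob {x \<in> space M. P n x}" for n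
  have p01: "0 \<le> p n" "p n \<le> 1" for n by (auto simp: p_def)
  have compl: "prob {x \<in> space M. \<not> P n x} = 1 - p n" for n
    unfolding p_def by (rule prob_neg) simp
  have "AE x in M. \<exists>n\<ge>m. P n x" for m
  proof -
    define Z where "Z = {x \<in> space M. \<forall>n\<ge>m. \<not> P n x}"
    have Z[measurable]: "Z \<in> events" unfolding Z_def by measurable
    \<comment> \<open>\<open>j > 0\<close> keeps the index set non-empty, as the product rule for
      independent events demands; the intersection over the empty set would be
      \<open>UNIV\<close>.\<close>
    have bound: "prob Z \<le> exp (- (\<Sum>n=m..<m+j. p n))" if "j > 0" for j
    proof -
      have "prob Z \<le> prob (\<Inter>n\<in>{m..<m+j}. P n -` {False} \<inter> space M)"
      proof (rule finite_measure_mono)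
        show "Z \<subseteq> (\<Inter>n\<in>{m..<m+j}. P n -` {False} \<inter> space M)" by (simp add: Z_def subset_iff)
        show "(\<Inter>n\<in>{m..<m+j}. P n -` {False} \<inter> space M) \<in> events"
          by (intro sets.finite_INT measurable_sets[OF Pm]) (simp_all add: that)
      qed
      also have "\<dots> = (\<Prod>n\<in>{m..<m+j}. prob (P n -` {False} \<inter> space M))"
        by (rule indep_varsD[OF indep]) (simp_all add: that)
      also have "\<dots> = (\<Prod>n\<in>{m..<m+j}. 1 - p n)"
      proof (rule prod.cong)
        fix n
        have "P n -` {False} \<inter> space M = {x \<in> space M. \<not> P n x}" by auto
        then show "prob (P n -` {False} \<inter> space M) = 1 - p n" by (simp only: compl)
      qed simp
      also have "\<dots> \<le> (\<Prod>n\<in>{m..<m+j}. exp (- p n))"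
      proof (intro prod_mono conjI)
        fix n show "0 \<le> 1 - p n" "1 - p n \<le> exp (- p n)"
          using p01[of n] exp_ge_add_one_self[of "- p n"] by simp_all
      qed
      also have "\<dots> = exp (- (\<Sum>n=m..<m+j. p n))"
        by (simp add: exp_sum flip: sum_negf)
      finally show ?thesis .
    qed
    have "prob Z = 0"
    proof (rule ccontr)
      assume "prob Z \<noteq> 0"
      then have pos: "prob Z > 0" by (simp add: zero_less_measure_iff)
      have "summable p"
      proof (rule bounded_imp_summable[of _ "(\<Sum>n<m. p n) + (- ln (prob Z))"])
        fix n
        have le: "(\<Sum>i=m..<m+Suc n. p i) \<le> - ln (prob Z)"
          using ln_mono[OF bound[of "Suc n"] pos] unfolding ln_exp by simp
        have "(\<Sum>i\<le>n. p i) \<le> (\<Sum>i\<in>{..<m} \<union> {m..<m+Suc n}. p i)"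
          using p01 by (intro sum_mono2) auto
        also have "\<dots> = (\<Sum>i<m. p i) + (\<Sum>i=m..<m+Suc n. p i)"
          by (intro sum.union_disjoint) auto
        finally show "(\<Sum>i\<le>n. p i) \<le> (\<Sum>i<m. p i) + (- ln (prob Z))" using le by simp
      qed (use p01 in auto)
      with div show False by (simp add: p_def[abs_def])
    qed
    then have "AE x in M. x \<notin> Z" using prob_eq_0[OF Z] by simp
    then show ?thesis
      using AE_space by eventually_elim (auto simp: Z_def)
  qed
  then have "AE x in M. \<forall>m. \<exists>n\<ge>m. P n x" by (simp add: AE_all_countable)
  then show ?thesis by (simp add: frequently_sequentially)
qed

text \<open>\<open>g\<close> lives on a single factor; the i.i.d. sequence under study is
  \<open>g (\<omega> i)\<close> on the product space \<open>PH \<mu>\<close>. The uniform bound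
  makes Hoeffding's inequality available.\<close>

locale bounded_iid = prob_space \<mu> for \<mu> :: "'l measure" +
  fixes g :: "'l \<Rightarrow> real" and B :: real
  assumes g[measurable]: "g \<in> borel_measurable \<mu>"
    and bounded: "\<And>x. x \<in> space \<mu> \<Longrightarrow> \<bar>g x\<bar> \<le> B"
    and B_pos: "0 < B"
begin

abbreviation "m \<equiv> expectation g"

sublocale PH: prob_space "PH \<mu>"
  unfolding PH_def by (intro prob_space_PiM prob_space_axioms)

lemma space_PH: "\<omega> \<in> space (PH \<mu>) \<Longrightarrow> \<omega> i \<in> space \<mu>"
  by (auto simp: PH_def space_PiM)

lemma coord_measurable[measurable]: "(\<lambda>\<omega>. \<omega> i) \<in> measurable (PH \<mu>) \<mu>"
  by (simp add: PH_def)

lemma distr_coord: "distr (PH \<mu>) \<mu> (\<lambda>\<omega>. \<omega> i) = \<mu>"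
  unfolding PH_def by (rule distr_PiM_component) (auto intro: prob_space_axioms)

text \<open>Independence amounts to the joint distribution being the product of the marginals; under
  the product measure the joint map is the identity and each marginal is
  \<open>\<mu>\<close>.\<close>

lemma indep_coords: "PH.indep_vars (\<lambda>_. \<mu>) (\<lambda>i \<omega>. \<omega> i) UNIV"
proof (subst PH.indep_vars_iff_distr_eq_PiM')
  have "distr (PH \<mu>) (\<Pi>\<^sub>M i\<in>UNIV. \<mu>) (\<lambda>x. \<lambda>i\<in>UNIV. x i) = PH \<mu>"
    unfolding restrict_UNIV PH_def by simp
  then show "distr (PH \<mu>) (\<Pi>\<^sub>M i\<in>UNIV. \<mu>) (\<lambda>x. \<lambda>i\<in>UNIV. x i) =
     (\<Pi>\<^sub>M i\<in>UNIV. distr (PH \<mu>) \<mu> (\<lambda>\<omega>. \<omega> i))"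
    by (simp add: distr_coord) (simp add: PH_def)
qed auto

lemma indep: "PH.indep_vars (\<lambda>_. borel) (\<lambda>i \<omega>. g (\<omega> i)) UNIV"
  by (rule PH.indep_vars_compose2[OF indep_coords]) simp

lemma expectation_coord:
  assumes [measurable]: "h \<in> borel_measurable \<mu>"
  shows "PH.expectation (\<lambda>\<omega>. h (\<omega> i)) = (expectation h :: real)"
  by (subst (2) distr_coord[of i, symmetric]) (subst integral_distr, auto)

lemma integrable_g: "integrable \<mu> g"
  by (rule integrable_const_bound[of _ B]) (use bounded in auto)

lemma distr_g_coord: "distr (PH \<mu>) borel (\<lambda>\<omega>. g (\<omega> i)) = distr \<mu> borel g"
  by (subst (2) distr_coord[of i, symmetric]) (subst distr_distr, auto simp: comp_def)

text \<open>Reindexing a product of identical factors along the injection i -> i + k preserves the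
  measure. This lets every block of consecutive coordinates be treated like the first one.\<close>

lemma shift_measure:
  assumes [measurable]: "Measurable.pred (PH \<mu>) Q"
  shows "PH.prob {\<omega> \<in> space (PH \<mu>). Q (\<lambda>i. \<omega> (i + k))} = PH.prob {\<omega> \<in> space (PH \<mu>). Q \<omega>}"
proof -
  have T[measurable]: "(\<lambda>\<omega> i. \<omega> (i + k)) \<in> measurable (PH \<mu>) (PH \<mu>)"
    unfolding PH_def by (rule measurable_PiM_single') (auto simp: space_PiM PiE_iff)
  have "distr (PH \<mu>) (PH \<mu>) (\<lambda>\<omega> i. \<omega> (i + k)) = PH \<mu>"
    using distr_PiM_reindex[of UNIV "\<lambda>_. \<mu>" "\<lambda>i. i + k" UNIV] prob_space_axioms
    unfolding PH_def restrict_UNIV by simp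
  then have "PH.prob {\<omega> \<in> space (PH \<mu>). Q \<omega>} =
      measure (distr (PH \<mu>) (PH \<mu>) (\<lambda>\<omega> i. \<omega> (i + k))) {\<omega> \<in> space (PH \<mu>). Q \<omega>}"
    by simp
  also have "\<dots> = PH.prob {\<omega> \<in> space (PH \<mu>). Q (\<lambda>i. \<omega> (i + k))}"
    by (subst measure_distr)
       (auto intro!: arg_cong[where f=PH.prob] dest: measurable_space[OF T])
  finally show ?thesis by simp
qed

section \<open>Concentration and central limit bounds for partial sums\<close>

lemma hoeffding:
  assumes "e \<ge> 0" "n > 0"
  shows "PH.prob {\<omega> \<in> space (PH \<mu>). \<bar>(\<Sum>i<n. g (\<omega> i)) - real n * m\<bar> \<ge> e}
    \<le> 2 * exp (- (e\<^sup>2 / (2 * real n * B\<^sup>2)))"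
proof -
  interpret H: Hoeffding_ineq "PH \<mu>" "{..<n}" "\<lambda>i \<omega>. g (\<omega> i)" "\<lambda>_. - B" "\<lambda>_. B" "real n * m"
  proof unfold_locales
    show "PH.indep_vars (\<lambda>_. borel) (\<lambda>i \<omega>. g (\<omega> i)) {..<n}"
      by (rule PH.indep_vars_subset[OF indep]) simp
    show "AE x in PH \<mu>. g (x i) \<in> {- B..B}" for i
      using AE_space by eventually_elim (use bounded space_PH in \<open>auto simp: abs_le_iff minus_le_iff\<close>)
    show "real n * m \<equiv> \<Sum>i<n. PH.expectation (\<lambda>\<omega>. g (\<omega> i))"
      by (simp add: expectation_coord)
  qed simp
  \<comment> \<open>Each term ranges over an interval of length \<open>2 * B\<close>, so the squared
    lengths sum to 4 n B^2.\<close>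
  have "-2 * e\<^sup>2 / (\<Sum>i<n. (B - (-B))\<^sup>2) = - (e\<^sup>2 / (2 * real n * B\<^sup>2))"
    using assms B_pos by (simp add: field_simps power2_eq_square)
  then show ?thesis
    using H.Hoeffding_ineq_abs_ge[OF assms(1)] assms B_pos by (simp only: mult_minus_left) auto
qed

text \<open>Hoeffding's inequality at deviation \<open>e * real n\<close> gives geometrically
  decaying probabilities, so the first Borel-Cantelli lemma applies. It will be used with
  \<open>e\<close> a multiple of the pressure.\<close>

lemma strong_law:
  assumes "e > 0"
  shows "AE \<omega> in PH \<mu>. \<forall>\<^sub>F n in sequentially. \<bar>(\<Sum>i<n. g (\<omega> i)) - real n * m\<bar> < e * real n"
proof -
  define A where "A n = {\<omega> \<in> space (PH \<mu>). \<bar>(\<Sum>i<n. g (\<omega> i)) - real n * m\<bar> \<ge> e * real n}" for n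
  define q where "q = exp (- (e\<^sup>2 / (2 * B\<^sup>2)))"
  have q: "0 < q" "q < 1" using assms B_pos by (auto simp: q_def)
  have [measurable]: "A n \<in> sets (PH \<mu>)" for n unfolding A_def by measurable
  have "PH.prob (A n) \<le> 2 * q ^ n" if "n > 0" for n
  proof -
    have "(e * real n)\<^sup>2 / (2 * real n * B\<^sup>2) = real n * (e\<^sup>2 / (2 * B\<^sup>2))"
      using that by (simp add: field_simps power2_eq_square)
    then show ?thesis
      using hoeffding[of "e * real n" n] that assms unfolding A_def q_def
      by (simp add: exp_of_nat_mult[symmetric])
  qed
  then have "summable (\<lambda>n. PH.prob (A n))"
    by (intro summable_comparison_test'[OF summable_mult[OF summable_geometric], of q 1 _ 2])
       (use q in simp_all)
  then have "AE \<omega> in PH \<mu>. \<forall>\<^sub>F n in sequentially. \<omega> \<in> space (PH \<mu>) - A n"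
    by (intro borel_cantelli_AE1) (auto simp: PH.emeasure_eq_measure)
  then show ?thesis
    by eventually_elim (auto simp: A_def elim!: eventually_mono)
qed

text \<open>By the central limit theorem the probability of lying at least one standard deviation
  below the mean tends to the standard normal mass of the half-line up to -1. This mass is positive,
  so a smaller positive number is a lower bound for all large n.\<close>

lemma lower_deviation:
  assumes m0: "m = 0" and var: "variance g > 0"
  shows "\<exists>p \<sigma> n0. 0 < p \<and> p < 1 \<and> 0 < \<sigma> \<and>
    (\<forall>n\<ge>n0. PH.prob {\<omega> \<in> space (PH \<mu>). (\<Sum>i<n. g (\<omega> i)) \<le> - \<sigma> * sqrt (real n)} \<ge> p)"
proof -
  define \<sigma> where "\<sigma> = sqrt (variance g)"
  have \<sigma>: "\<sigma> > 0" "\<sigma>\<^sup>2 = variance g" "\<bar>\<sigma>\<bar> = \<sigma>" using var by (auto simp: \<sigma>_def)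
  let ?D = "\<lambda>n. distr (PH \<mu>) borel (\<lambda>x. (\<Sum>i<n. g (x i)) / sqrt (real n * \<sigma>\<^sup>2))"
  have "weak_conv_m ?D std_normal_distribution"
  proof (rule PH.central_limit_theorem_zero_mean[OF indep _ \<sigma>(1)])
    fix n
    show "PH.expectation (\<lambda>\<omega>. g (\<omega> n)) = 0" by (simp add: expectation_coord m0)
    show "integrable (PH \<mu>) (\<lambda>x. (g (x n))\<^sup>2)"
    proof (rule PH.integrable_const_bound[of _ "B\<^sup>2"])
      show "AE x in PH \<mu>. norm ((g (x n))\<^sup>2) \<le> B\<^sup>2"
        using AE_space
      proof eventually_elim
        case (elim x)
        then have "\<bar>g (x n)\<bar> \<le> B" using bounded space_PH by auto
        then show ?case using power_mono[of "\<bar>g (x n)\<bar>" B 2] by simp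
      qed
    qed simp
    show "PH.variance (\<lambda>\<omega>. g (\<omega> n)) = \<sigma>\<^sup>2"
      by (simp add: expectation_coord \<sigma>(2) expectation_coord[where h="\<lambda>x. (g x - m)\<^sup>2"])
    show "distr (PH \<mu>) borel (\<lambda>\<omega>. g (\<omega> n)) = distr \<mu> borel g" by (rule distr_g_coord)
  qed
  moreover interpret N: real_distribution std_normal_distribution
    by (rule real_dist_normal_dist)
  define q where "q = cdf std_normal_distribution (-1)"
  \<comment> \<open>Weak convergence yields convergence of distribution functions at continuity
    points, so an atom at -1 has to be excluded.\<close>
  have "emeasure std_normal_distribution {a} = 0" for a :: real
    by (subst emeasure_density) (auto simp: nn_integral_cmult_indicator nn_integral_indicator_singleton)
  then have "measure std_normal_distribution {-1} = 0"
    by (simp add: measure_def)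
  then have "isCont (cdf std_normal_distribution) (-1)"
    by (simp add: N.isCont_cdf)
  ultimately have lim: "(\<lambda>n. cdf (?D n) (-1)) \<longlonglongrightarrow> q"
    by (simp add: weak_conv_m_def weak_conv_def q_def)
  have "q > 0"
  proof (rule ccontr)
    assume "\<not> q > 0"
    then have "emeasure std_normal_distribution {..-1::real} = 0"
      using measure_nonneg[of std_normal_distribution "{..-1}"]
      by (simp add: q_def cdf_def N.emeasure_eq_measure not_less antisym)
    \<comment> \<open>The density is positive everywhere, so a null set of the normal law is
      Lebesgue null; a half-line contains an interval of length one and is not.\<close>
    then have "AE x in lborel. ennreal (std_normal_density x) * indicator {..-1::real} x = 0"
      by (subst (asm) emeasure_density) (simp_all add: nn_integral_0_iff_AE)
    then have "AE x in lborel. x \<notin> {..-1::real}"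
    proof eventually_elim
      case (elim x)
      have "std_normal_density x > 0" by (rule normal_density_pos) simp
      with elim show ?case by (auto split: split_indicator_asm)
    qed
    then have "emeasure lborel {..-1::real} = 0"
      by (subst (asm) AE_iff_measurable[of "{..-1}"]) (simp_all add: atMost_def)
    moreover have "emeasure lborel {-2..-1::real} \<le> emeasure lborel {..-1::real}"
      by (rule emeasure_mono) auto
    ultimately show False by simp
  qed
  \<comment> \<open>Half of the limit lies strictly below it; the cap at 1/2 yields
    \<open>p < 1\<close>, so that \<open>ln p\<close> is negative when the number of blocks is
    chosen.\<close>
  then have "\<forall>\<^sub>F n in sequentially. cdf (?D n) (-1) > min (q/2) (1/2)"
    by (intro order_tendstoD(1)[OF lim]) (auto simp: min_def)
  then obtain n0 where n0: "\<And>n. n \<ge> n0 \<Longrightarrow> cdf (?D n) (-1) > min (q/2) (1/2)"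
    by (auto simp: eventually_sequentially)
  show ?thesis
  \<comment> \<open>The threshold \<open>Suc n0\<close> makes n positive, so that the inequality may
    be multiplied by sqrt n.\<close>
  proof (rule exI[of _ "min (q/2) (1/2)"], rule exI[of _ \<sigma>], rule exI[of _ "Suc n0"], intro conjI allI impI)
    fix n assume n: "Suc n0 \<le> n"
    have "cdf (?D n) (-1) = PH.prob {\<omega> \<in> space (PH \<mu>). (\<Sum>i<n. g (\<omega> i)) \<le> - \<sigma> * sqrt (real n)}"
      using n \<sigma>(1,3) unfolding cdf_def
      by (subst measure_distr)
         (auto intro!: arg_cong[where f=PH.prob] simp: real_sqrt_mult field_simps)
    then show "PH.prob {\<omega> \<in> space (PH \<mu>). (\<Sum>i<n. g (\<omega> i)) \<le> - \<sigma> * sqrt (real n)} \<ge> min (q/2) (1/2)"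
      using n0[of n] n by simp
  qed (use \<open>q > 0\<close> \<sigma> in auto)
qed

end

section \<open>A weak law of the iterated logarithm\<close>

text \<open>
  The \<open>n\<close>-th interval starts at \<open>block_start \<kappa> n0 n\<close> and consists of \<open>block_count \<kappa> n\<close> blocks.  The factor
  \<open>(Suc n)\<^sup>2\<close> in the block length makes everything before the interval negligible, with summable error
  probabilities; the parameter \<open>\<kappa>\<close> will be \<open>1 / ln (1 / p)\<close>.
\<close>

abbreviation block_count :: "real \<Rightarrow> nat \<Rightarrow> nat" where
  "block_count \<kappa> n \<equiv> Suc (nat \<lfloor>\<kappa> * ln (real (Suc n))\<rfloor>)"

primrec block_start :: "real \<Rightarrow> nat \<Rightarrow> nat \<Rightarrow> nat" where
  "block_start \<kappa> n0 0 = Suc n0"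
| "block_start \<kappa> n0 (Suc n) =
     block_start \<kappa> n0 n + block_count \<kappa> n * ((Suc n)\<^sup>2 * block_start \<kappa> n0 n)"

abbreviation block_length :: "real \<Rightarrow> nat \<Rightarrow> nat \<Rightarrow> nat" where
  "block_length \<kappa> n0 n \<equiv> (Suc n)\<^sup>2 * block_start \<kappa> n0 n"

section \<open>Growth of the block times\<close>

context
  fixes \<kappa> :: real and n0 :: nat
  assumes \<kappa>: "0 < \<kappa>"
begin

lemma block_start_gt: "n0 < block_start \<kappa> n0 n"
  by (induction n) auto

text \<open>Ensures that block lengths exceed \<open>n0\<close>, where the central limit bound is
  valid, and that the end of an interval is at most twice the total length of its blocks.\<close>

lemma block_start_le_length: "block_start \<kappa> n0 n \<le> block_length \<kappa> n0 n"
  using mult_le_mono1[OF one_le_power[of "Suc n" 2], of "block_start \<kappa> n0 n"] by simp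

lemma block_start_ge: "n \<le> block_start \<kappa> n0 n"
proof (induction n)
  case (Suc n)
  have "1 * (1 * 1) \<le> block_count \<kappa> n * ((Suc n)\<^sup>2 * block_start \<kappa> n0 n)"
    using block_start_gt[of n] by (intro mult_le_mono) auto
  with Suc show ?case by simp
qed simp

lemma block_count_bounds: "\<kappa> * ln (real (Suc n)) \<le> real (block_count \<kappa> n)" "real (block_count \<kappa> n) \<le> 1 + \<kappa> * ln (real (Suc n))"
proof -
  have "0 \<le> \<kappa> * ln (real (Suc n))" using \<kappa> by simp
  then show "\<kappa> * ln (real (Suc n)) \<le> real (block_count \<kappa> n)" "real (block_count \<kappa> n) \<le> 1 + \<kappa> * ln (real (Suc n))"
    by linarith+
qed

text \<open>With x = n + 1, one step multiplies the time by
  \<open>1 + real (block_count \<kappa> n) * x\<^sup>2\<close>. The logarithm of this factor is at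
  most (\<kappa> + 1) x^3, and summing cubes gives a fourth power.\<close>

lemma ln_block_start_le:
  "ln (real (block_start \<kappa> n0 n)) \<le> (ln (real (Suc n0)) + \<kappa> + 1) * real (Suc n) ^ 4"
proof (induction n)
  case 0
  then show ?case using \<kappa> by simp
next
  case (Suc n)
  define A where "A = ln (real (Suc n0)) + \<kappa> + 1"
  define x where "x = real (Suc n)"
  have x: "x \<ge> 1" by (simp add: x_def)
  have A: "\<kappa> + 1 \<le> A" by (simp add: A_def)
  have Kpos: "real (block_start \<kappa> n0 n) > 0" using block_start_gt[of n] by simp
  have "real (block_start \<kappa> n0 (Suc n)) = real (block_start \<kappa> n0 n) * (1 + real (block_count \<kappa> n) * x\<^sup>2)"
    by (simp add: x_def algebra_simps)
  then have "ln (real (block_start \<kappa> n0 (Suc n))) = ln (real (block_start \<kappa> n0 n)) + ln (1 + real (block_count \<kappa> n) * x\<^sup>2)"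
    using Kpos ln_mult_pos[of "real (block_start \<kappa> n0 n)" "1 + real (block_count \<kappa> n) * x\<^sup>2"] by (simp add: add_pos_nonneg del: block_start.simps of_nat_Suc)
  also have "ln (1 + real (block_count \<kappa> n) * x\<^sup>2) \<le> real (block_count \<kappa> n) * x\<^sup>2"
    by (intro ln_add_one_self_le_self) simp
  also have "real (block_count \<kappa> n) * x\<^sup>2 \<le> ((\<kappa> + 1) * x) * x\<^sup>2"
  proof (intro mult_right_mono)
    have "\<kappa> * ln x \<le> \<kappa> * x" using \<kappa> x ln_le_minus_one[of x] by (intro mult_left_mono) auto
    moreover have "(\<kappa> + 1) * x = \<kappa> * x + x" by (simp add: algebra_simps)
    ultimately show "real (block_count \<kappa> n) \<le> (\<kappa> + 1) * x"
      using block_count_bounds(2)[of n] x unfolding x_def[symmetric] by linarith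
  qed simp
  also have "((\<kappa> + 1) * x) * x\<^sup>2 \<le> (A * x) * x\<^sup>2"
    using A x by (intro mult_right_mono) auto
  finally have "ln (real (block_start \<kappa> n0 (Suc n))) \<le> A * (x ^ 4 + x ^ 3)"
    using Suc unfolding A_def[symmetric] x_def[symmetric] by (simp add: algebra_simps power2_eq_square power3_eq_cube)
  also have "\<dots> \<le> A * (x + 1) ^ 4"
  proof (intro mult_left_mono)
    have "0 \<le> 1 + x * 4 + x\<^sup>2 * 6 + x ^ 3 * 3" using x by simp
    also have "\<dots> = (x + 1) ^ 4 - (x ^ 4 + x ^ 3)" by (simp add: algebra_simps power4_eq_xxxx power2_eq_square power3_eq_cube)
    finally show "x ^ 4 + x ^ 3 \<le> (x + 1) ^ 4" by simp
  qed (use A \<kappa> in simp)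
  finally show ?case by (simp add: A_def x_def add.commute)
qed

text \<open>The iterated logarithm of the end time is O(ln n), while there are at least \<kappa> ln
  (n + 1) blocks. Thus the factor ln (ln K) in the law of the iterated logarithm is paid for by the
  number of blocks.\<close>

lemma ln_ln_block_start_le:
  shows "\<exists>C>0. \<forall>n. ln (ln (real (block_start \<kappa> n0 (Suc n)))) \<le> C * real (block_count \<kappa> n)"
proof -
  define A where "A = ln (real (Suc n0)) + \<kappa> + 1"
  have A: "1 \<le> A" using \<kappa> by (simp add: A_def)
  \<comment> \<open>\<open>4 / \<kappa>\<close> converts 4 ln (n + 1) into a number of blocks; the
    constant terms are absorbed because there is at least one block.\<close>
  define C where "C = ln A + 4 * ln 2 + 4 / \<kappa>"
  show ?thesis
  proof (intro exI[of _ C] conjI allI)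
    show "0 < C" using A \<kappa> by (simp add: C_def add_nonneg_pos)
    fix n
    have K2: "2 \<le> block_start \<kappa> n0 (Suc n)"
    proof -
      have "1 * (1 * 1) \<le> block_count \<kappa> n * ((Suc n)\<^sup>2 * block_start \<kappa> n0 n)"
        using block_start_gt[of n] by (intro mult_le_mono) auto
      then show ?thesis using block_start_gt[of n] by simp
    qed
    then have "0 < ln (real (block_start \<kappa> n0 (Suc n)))" by (simp del: block_start.simps)
    then have "ln (ln (real (block_start \<kappa> n0 (Suc n)))) \<le> ln (A * real (Suc (Suc n)) ^ 4)"
      using ln_block_start_le[of "Suc n"] by (intro ln_mono) (simp_all add: A_def)
    also have "\<dots> = ln A + 4 * ln (real (Suc (Suc n)))"
      using A by (simp add: ln_mult ln_realpow)
    also have "ln (real (Suc (Suc n))) \<le> ln (2 * real (Suc n))" by (intro ln_mono) auto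
    also have "ln (2 * real (Suc n)) = ln 2 + ln (real (Suc n))" by (intro ln_mult_pos) auto
    also have "ln (real (Suc n)) \<le> real (block_count \<kappa> n) / \<kappa>"
      using block_count_bounds(1)[of n] \<kappa> by (simp add: field_simps)
    also have "ln A + 4 * (ln 2 + real (block_count \<kappa> n) / \<kappa>) \<le> (ln A + 4 * ln 2) * real (block_count \<kappa> n) + 4 * (real (block_count \<kappa> n) / \<kappa>)"
      using A mult_left_mono[of 1 "real (block_count \<kappa> n)" "ln A + 4 * ln 2"] by simp
    also have "\<dots> = C * real (block_count \<kappa> n)" by (simp add: C_def add_divide_distrib algebra_simps)
    finally show "ln (ln (real (block_start \<kappa> n0 (Suc n)))) \<le> C * real (block_count \<kappa> n)" by simp
  qed
qed

end

section \<open>Independence and probability of the blocks\<close>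

lemma sum_consecutive_blocks:
  fixes F :: "nat \<Rightarrow> real"
  shows "(\<Sum>l<L. \<Sum>i\<in>{k + l * b..<k + Suc l * b}. F i) = (\<Sum>i\<in>{k..<k + L * b}. F i)"
proof (induction L)
  case (Suc L)
  have "(\<Sum>i\<in>{k..<k + Suc L * b}. F i) = (\<Sum>i\<in>{k..<k + L * b}. F i) + (\<Sum>i\<in>{k + L * b..<k + Suc L * b}. F i)"
    by (intro sum.atLeastLessThan_concat[symmetric]) auto
  with Suc show ?case by simp
qed simp

context bounded_iid
begin

lemma block_prob:
  "PH.prob {\<omega> \<in> space (PH \<mu>). (\<Sum>i\<in>{k..<k+n}. g (\<omega> i)) \<le> a} =
   PH.prob {\<omega> \<in> space (PH \<mu>). (\<Sum>i<n. g (\<omega> i)) \<le> a}"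
proof -
  have "(\<Sum>i\<in>{k..<k+n}. g (\<omega> i)) = (\<Sum>i<n. g (\<omega> (i + k)))" for \<omega>
    by (rule sum.reindex_bij_witness[of _ "\<lambda>i. i + k" "\<lambda>i. i - k"]) auto
  then show ?thesis
    using shift_measure[of "\<lambda>\<omega>. (\<Sum>i<n. g (\<omega> i)) \<le> a" k] by simp
qed

text \<open>Sums over disjoint blocks are independent, and by shift invariance each is distributed
  like the first one, so the probabilities multiply.\<close>

lemma blocks_prob_ge:
  assumes p: "PH.prob {\<omega> \<in> space (PH \<mu>). (\<Sum>i<n. g (\<omega> i)) \<le> a} \<ge> p" "p \<ge> 0" and L: "L > 0"
  shows "PH.prob {\<omega> \<in> space (PH \<mu>). \<forall>l<L. (\<Sum>i\<in>{k + l * n..<k + Suc l * n}. g (\<omega> i)) \<le> a} \<ge> p ^ L"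
proof -
  define J where "J l = {k + l * n..<k + Suc l * n}" for l
  define Z where "Z l \<omega> = (\<Sum>i\<in>J l. g (\<omega> i))" for l and \<omega> :: "nat \<Rightarrow> 'l"
  have disj: "disjoint_family_on J {..<L}"
    unfolding J_def disjoint_family_on_def
  proof (intro ballI impI)
    fix l l' :: nat assume "l \<noteq> l'"
    then have "Suc l \<le> l' \<or> Suc l' \<le> l" by linarith
    then have "Suc l * n \<le> l' * n \<or> Suc l' * n \<le> l * n" by (metis mult_le_mono1)
    then show "{k + l * n..<k + Suc l * n} \<inter> {k + l' * n..<k + Suc l' * n} = {}" by auto
  qed
  have "PH.indep_vars (\<lambda>_. borel) (\<lambda>l \<omega>. \<Sum>i\<in>J l. (\<lambda>i\<in>J l. g (\<omega> i)) i) {..<L}"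
    by (rule PH.indep_vars_compose2[OF PH.indep_vars_restrict[OF indep _ disj]]) (auto simp: J_def)
  then have Zi: "PH.indep_vars (\<lambda>_. borel) Z {..<L}" by (simp add: Z_def[abs_def] cong: sum.cong)
  have "p ^ L = (\<Prod>l<L. p)" by simp
  also have "\<dots> \<le> (\<Prod>l<L. PH.prob (Z l -` {..a} \<inter> space (PH \<mu>)))"
  proof (intro prod_mono conjI p(2))
    fix l
    have "Z l -` {..a} \<inter> space (PH \<mu>) =
        {\<omega> \<in> space (PH \<mu>). (\<Sum>i\<in>{(k + l * n)..<(k + l * n) + n}. g (\<omega> i)) \<le> a}"
      by (auto simp: Z_def J_def algebra_simps)
    then show "p \<le> PH.prob (Z l -` {..a} \<inter> space (PH \<mu>))"
      using p(1) by (simp only: block_prob)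
  qed
  also have "\<dots> = PH.prob (\<Inter>l\<in>{..<L}. Z l -` {..a} \<inter> space (PH \<mu>))"
    using L by (intro PH.indep_varsD_finite[OF Zi, symmetric]) auto
  also have "(\<Inter>l\<in>{..<L}. Z l -` {..a} \<inter> space (PH \<mu>)) =
      {\<omega> \<in> space (PH \<mu>). \<forall>l<L. (\<Sum>i\<in>{k + l * n..<k + Suc l * n}. g (\<omega> i)) \<le> a}"
    using L by (auto simp: Z_def J_def)
  finally show ?thesis .
qed

text \<open>On the favourable events the past costs at most half of what one block gains, so the sum
  up to the end K of an interval with L blocks of length b is at most -(\<sigma>/2) L sqrt b. Since
  K \<le> 2 L b and ln (ln K) \<le> C L, this is at most a negative multiple of sqrt (K ln (ln
  K)).\<close>

lemma weak_iterated_logarithm: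
  assumes m0: "m = 0" and var: "variance g > 0"
  shows "\<exists>\<delta>>0. AE \<omega> in PH \<mu>. \<exists>\<^sub>F n in sequentially.
       (\<Sum>i<n. g (\<omega> i)) \<le> - \<delta> * sqrt (real n * ln (ln (real n)))"
proof -
  obtain p \<sigma> n0 where p: "0 < p" "p < 1" "0 < \<sigma>" and
    dev: "\<forall>n\<ge>n0. PH.prob {\<omega> \<in> space (PH \<mu>). (\<Sum>i<n. g (\<omega> i)) \<le> - \<sigma> * sqrt (real n)} \<ge> p"
    using lower_deviation[OF m0 var] by (elim exE conjE)
  \<comment> \<open>With this choice the power of p with exponent \<kappa> ln (n + 1) is 1 / (n +
    1), so the events \<open>R n\<close> have probability at least \<open>p / real (Suc n)\<close>,
    which still diverges.\<close>
  define \<kappa> where "\<kappa> = 1 / (- ln p)"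
  have \<kappa>: "0 < \<kappa>" using p by (simp add: \<kappa>_def)
  let ?L = "block_count \<kappa>" and ?K = "block_start \<kappa> n0" and ?b = "block_length \<kappa> n0"
  have Kpos: "?K n > 0" for n using block_start_gt[OF \<kappa>, of n0 n] by simp
  define R where "R n \<omega> \<longleftrightarrow> (\<forall>l<?L n. (\<Sum>i\<in>{?K n + l * ?b n..<?K n + Suc l * ?b n}. g (\<omega> i))
      \<le> - \<sigma> * sqrt (real (?b n)))" for n and \<omega> :: "nat \<Rightarrow> 'l"
  have Rprob: "PH.prob {\<omega> \<in> space (PH \<mu>). R n \<omega>} \<ge> p / real (Suc n)" for n
  proof -
    have "?b n \<ge> n0"
      using block_start_gt[OF \<kappa>, of n0 n] block_start_le_length[OF \<kappa>, of n0 n] by linarith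
    then have "p ^ ?L n \<le> PH.prob {\<omega> \<in> space (PH \<mu>). R n \<omega>}"
      unfolding R_def using p dev by (intro blocks_prob_ge) auto
    moreover have "p / real (Suc n) \<le> p ^ ?L n"
    proof -
      have "p / real (Suc n) = exp (ln p - ln (real (Suc n)))"
        using p by (simp add: exp_diff)
      also have "\<dots> = exp ((1 + \<kappa> * ln (real (Suc n))) * ln p)"
        using p by (simp add: \<kappa>_def field_simps)
      also have "\<dots> \<le> exp (real (?L n) * ln p)"
        using block_count_bounds(2)[OF \<kappa>, of n] p by (simp del: of_nat_Suc add: mult_right_mono_neg)
      also have "\<dots> = p ^ ?L n" using p by (simp only: exp_of_nat_mult exp_ln)
      finally show ?thesis .
    qed
    ultimately show ?thesis by linarith
  qed
  have "PH.indep_vars (\<lambda>_. count_space UNIV) R UNIV"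
  proof -
    define J where "J n = {?K n..<?K (Suc n)}" for n
    have mono: "?K n \<le> ?K n'" if "n \<le> n'" for n n'
      using that by (rule lift_Suc_mono_le[rotated]) auto
    have disj: "disjoint_family_on J UNIV"
      unfolding disjoint_family_on_def J_def
    proof (intro ballI impI)
      fix n n' :: nat assume "n \<noteq> n'"
      then have "Suc n \<le> n' \<or> Suc n' \<le> n" by linarith
      then have "?K (Suc n) \<le> ?K n' \<or> ?K (Suc n') \<le> ?K n" using mono by blast
      then show "{?K n..<?K (Suc n)} \<inter> {?K n'..<?K (Suc n')} = {}" by auto
    qed
    \<comment> \<open>\<open>Q n\<close> is \<open>R n\<close> read as a condition on the values
      indexed by \<open>J n\<close> alone; the sets \<open>J n\<close> are disjoint, so independence
      follows by grouping.\<close>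
    define Q where "Q n x \<longleftrightarrow> (\<forall>l\<in>{..<?L n}. (\<Sum>i\<in>{?K n + l * ?b n..<?K n + Suc l * ?b n}. x i)
      \<le> - \<sigma> * sqrt (real (?b n)))" for n and x :: "nat \<Rightarrow> real"
    have sub: "{?K n + l * ?b n..<?K n + Suc l * ?b n} \<subseteq> J n" if "l < ?L n" for n l
    proof -
      have "Suc l * ?b n \<le> ?L n * ?b n" using that by (intro mult_le_mono1) simp
      then show ?thesis by (auto simp: J_def simp del: mult_Suc)
    qed
    have [measurable]: "Q n \<in> measurable (Pi\<^sub>M (J n) (\<lambda>_. borel)) (count_space UNIV)" for n
    proof -
      have sum_meas: "(\<lambda>x. \<Sum>i\<in>{?K n + l * ?b n..<?K n + Suc l * ?b n}. x i) \<in> borel_measurable (Pi\<^sub>M (J n) (\<lambda>_. borel :: real measure))"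
        if "l \<in> {..<?L n}" for l
        using sub[of l n] that by (intro borel_measurable_sum measurable_component_singleton) auto
      have "Measurable.pred (Pi\<^sub>M (J n) (\<lambda>_. borel))
          (\<lambda>x. (\<Sum>i\<in>{?K n + l * ?b n..<?K n + Suc l * ?b n}. x i) \<le> - \<sigma> * sqrt (real (?b n)))"
        if "l \<in> {..<?L n}" for l
        unfolding pred_def by (intro borel_measurable_le borel_measurable_const) (rule sum_meas[OF that])
      then show ?thesis unfolding Q_def
        by (intro pred_intros_finite) auto
    qed
    have "PH.indep_vars (\<lambda>_. count_space UNIV) (\<lambda>n \<omega>. Q n (\<lambda>i\<in>J n. g (\<omega> i))) UNIV"
      by (rule PH.indep_vars_compose2[OF PH.indep_vars_restrict[OF indep _ disj]]) auto
    moreover have "Q n (\<lambda>i\<in>J n. g (\<omega> i)) = R n \<omega>" for n \<omega>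
    proof -
      have "(\<Sum>i\<in>{?K n + l * ?b n..<?K n + Suc l * ?b n}. (\<lambda>i\<in>J n. g (\<omega> i)) i) =
         (\<Sum>i\<in>{?K n + l * ?b n..<?K n + Suc l * ?b n}. g (\<omega> i))" if "l < ?L n" for l
        using sub[OF that] by (intro sum.cong) auto
      then show ?thesis unfolding Q_def R_def Ball_def lessThan_iff
        by (intro all_cong1 imp_cong refl) (simp only:)
    qed
    ultimately show ?thesis by simp
  qed
  moreover have "\<not> summable (\<lambda>n. PH.prob {\<omega> \<in> space (PH \<mu>). R n \<omega>})"
  proof
    assume "summable (\<lambda>n. PH.prob {\<omega> \<in> space (PH \<mu>). R n \<omega>})"
    then have "summable (\<lambda>n. p / real (Suc n))"
      by (rule summable_comparison_test'[where N=0]) (use Rprob p in auto)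
    then have "summable (\<lambda>n. (1/p) * (p / real (Suc n)))" by (rule summable_mult)
    then have "summable (\<lambda>n. inverse (real (Suc n)))" using p by (simp add: field_simps)
    then show False
      using not_summable_harmonic[where ?'a=real] summable_Suc_iff[of "\<lambda>n. inverse (real n)"] by blast
  qed
  ultimately have io: "AE \<omega> in PH \<mu>. \<exists>\<^sub>F n in sequentially. R n \<omega>"
    by (rule PH.borel_cantelli_2)

  \<comment> \<open>The bad event: the past is not negligible against one block. The past is shorter
    than a block by the factor \<open>(Suc n)\<^sup>2\<close>, so Hoeffding's exponent is a constant
    times this square and the probabilities are summable.\<close>
  define A where "A n = {\<omega> \<in> space (PH \<mu>).
      \<bar>(\<Sum>i<?K n. g (\<omega> i)) - real (?K n) * m\<bar> \<ge> \<sigma> / 2 * sqrt (real (?b n))}" for n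
  define q where "q = exp (- (\<sigma>\<^sup>2 / (8 * B\<^sup>2)))"
  have q: "0 < q" "q < 1" using p B_pos by (auto simp: q_def)
  have [measurable]: "A n \<in> sets (PH \<mu>)" for n unfolding A_def by measurable
  have "PH.prob (A n) \<le> 2 * q ^ n" for n
  proof -
    have "PH.prob (A n) \<le> 2 * exp (- ((\<sigma> / 2 * sqrt (real (?b n)))\<^sup>2 / (2 * real (?K n) * B\<^sup>2)))"
      unfolding A_def using p Kpos by (intro hoeffding) auto
    also have "(\<sigma> / 2 * sqrt (real (?b n)))\<^sup>2 / (2 * real (?K n) * B\<^sup>2) = real ((Suc n)\<^sup>2) * (\<sigma>\<^sup>2 / (8 * B\<^sup>2))"
      using Kpos[of n] B_pos by (simp add: power_mult_distrib power_divide field_simps)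
    also have "exp (- (real ((Suc n)\<^sup>2) * (\<sigma>\<^sup>2 / (8 * B\<^sup>2)))) = q ^ ((Suc n)\<^sup>2)"
      unfolding q_def by (subst exp_of_nat_mult[symmetric]) simp
    also have "q ^ ((Suc n)\<^sup>2) \<le> q ^ n"
      using q by (intro power_decreasing) (auto simp: power2_eq_square)
    finally show ?thesis by simp
  qed
  then have "summable (\<lambda>n. PH.prob (A n))"
    by (intro summable_comparison_test'[OF summable_mult[OF summable_geometric], of q 0 _ 2])
       (use q in simp_all)
  then have ev: "AE \<omega> in PH \<mu>. \<forall>\<^sub>F n in sequentially. \<omega> \<in> space (PH \<mu>) - A n"
    by (intro borel_cantelli_AE1) (auto simp: PH.emeasure_eq_measure)

  obtain C where C: "0 < C" "\<And>n. ln (ln (real (?K (Suc n)))) \<le> C * real (?L n)"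
    using ln_ln_block_start_le[OF \<kappa>] by blast
  \<comment> \<open>Chosen so that \<open>\<delta> * sqrt (2 * C)\<close> equals
    \<open>\<sigma> / 2\<close>; the factor 2 C comes from K ln (ln K) \<le> (2 l r^2) (C
    l).\<close>
  define \<delta> where "\<delta> = \<sigma> / (2 * sqrt (2 * C))"
  have \<delta>: "0 < \<delta>" using p C by (simp add: \<delta>_def)
  have key: "(\<Sum>i<?K (Suc n). g (\<omega> i)) \<le> - \<delta> * sqrt (real (?K (Suc n)) * ln (ln (real (?K (Suc n)))))"
    if R: "R n \<omega>" and A: "\<omega> \<in> space (PH \<mu>) - A n" for n \<omega>
  proof -
    define l where "l = real (?L n)"
    define r where "r = sqrt (real (?b n))"
    have l: "l \<ge> 1" by (simp add: l_def)
    have r: "r \<ge> 0" by (simp add: r_def)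
    have "(\<Sum>i<?K (Suc n). g (\<omega> i)) = (\<Sum>i<?K n. g (\<omega> i)) + (\<Sum>i\<in>{?K n..<?K n + ?L n * ?b n}. g (\<omega> i))"
      unfolding lessThan_atLeast0 block_start.simps(2)
      by (intro sum.atLeastLessThan_concat[symmetric]) auto
    also have "(\<Sum>i\<in>{?K n..<?K n + ?L n * ?b n}. g (\<omega> i)) =
      (\<Sum>j<?L n. \<Sum>i\<in>{?K n + j * ?b n..<?K n + Suc j * ?b n}. g (\<omega> i))"
      by (rule sum_consecutive_blocks[symmetric])
    also have "\<dots> \<le> (\<Sum>j<?L n. - \<sigma> * r)"
    proof (rule sum_mono)
      fix j assume "j \<in> {..<?L n}"
      then show "(\<Sum>i\<in>{?K n + j * ?b n..<?K n + Suc j * ?b n}. g (\<omega> i)) \<le> - \<sigma> * r"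
        using R by (simp only: R_def r_def lessThan_iff)
    qed
    also have "\<dots> = - \<sigma> * r * l" by (simp add: l_def)
    also have "(\<Sum>i<?K n. g (\<omega> i)) \<le> \<sigma> / 2 * r"
      using A unfolding A_def r_def m0 by auto
    also have "\<sigma> / 2 * r \<le> \<sigma> / 2 * r * l"
      using l r p mult_left_mono[of 1 l "\<sigma> / 2 * r"] by simp
    also have "\<sigma> / 2 * r * l + - \<sigma> * r * l = - (\<sigma> / 2) * (r * l)" by (simp add: field_simps)
    finally have 1: "(\<Sum>i<?K (Suc n). g (\<omega> i)) \<le> - (\<sigma> / 2) * (r * l)" by simp
    have "?K n \<le> ?L n * ?b n"
      using block_start_le_length[OF \<kappa>, of n0 n] mult_le_mono1[of 1 "?L n" "?b n"] by linarith
    then have "?K (Suc n) \<le> 2 * (?L n * ?b n)"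
      unfolding block_start.simps(2) by linarith
    then have "real (?K (Suc n)) \<le> real (2 * (?L n * ?b n))" by (simp only: of_nat_le_iff)
    also have "\<dots> = 2 * (l * r\<^sup>2)" unfolding l_def r_def of_nat_mult by simp
    finally have K2: "real (?K (Suc n)) \<le> 2 * (l * r\<^sup>2)" .
    have "C * l \<ge> ln (ln (real (?K (Suc n))))" using C(2) unfolding l_def by blast
    with K2 have
 "real (?K (Suc n)) * ln (ln (real (?K (Suc n)))) \<le> (2 * (l * r\<^sup>2)) * (C * l)"
      using C l r by (intro order_trans[OF mult_left_mono mult_right_mono]) (simp_all del: block_start.simps)
    also have "\<dots> = (sqrt (2 * C) * (r * l))\<^sup>2" using C by (simp add: power2_eq_square field_simps)
    finally have "sqrt (real (?K (Suc n)) * ln (ln (real (?K (Suc n))))) \<le> sqrt (2 * C) * (r * l)"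
      using C l r by (intro real_le_lsqrt) auto
    then have "\<delta> * sqrt (real (?K (Suc n)) * ln (ln (real (?K (Suc n))))) \<le> \<delta> * (sqrt (2 * C) * (r * l))"
      using \<delta> by (intro mult_left_mono) auto
    also have "\<dots> = \<sigma> / 2 * (r * l)" using C by (simp add: \<delta>_def)
    finally show ?thesis using 1 by simp
  qed
  have "AE \<omega> in PH \<mu>. \<exists>\<^sub>F n in sequentially.
       (\<Sum>i<n. g (\<omega> i)) \<le> - \<delta> * sqrt (real n * ln (ln (real n)))"
    using io ev
  proof eventually_elim
    case (elim \<omega>)
    have "\<exists>\<^sub>F n in sequentially. R n \<omega> \<and> \<omega> \<in> space (PH \<mu>) - A n"
      by (rule frequently_rev_mp[OF elim(1)]) (use elim(2) in \<open>auto elim!: eventually_mono\<close>)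
    then have "\<exists>\<^sub>F n in sequentially. (\<Sum>i<?K (Suc n). g (\<omega> i)) \<le> - \<delta> * sqrt (real (?K (Suc n)) * ln (ln (real (?K (Suc n)))))"
      by (rule frequently_elim1) (use key in blast)
    \<comment> \<open>The n-th time is at least n, so infinitely many good intervals give
      arbitrarily large times.\<close>
    then show ?case
      unfolding frequently_sequentially
      using block_start_ge[OF \<kappa>, of "Suc _" n0] by (meson le_SucI order_trans)
  qed
  then show ?thesis using \<delta> by blast
qed

end

section \<open>Covering and packing the attractor by cylinders\<close>

text \<open>After subtracting the value at 0 and dividing by the ratio, the map is an isometry
  fixing 0, hence orthogonal and onto. Surjectivity is what makes the image a full ball.\<close>

lemma similarity_image_ball:
  fixes g :: "'a::euclidean_space \<Rightarrow> 'a"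
  assumes sim: "\<And>x y. dist (g x) (g y) = a * dist x y" and a: "0 < a"
  shows "g ` ball x r = ball (g x) (a * r)"
proof -
  define h where "h y = (1 / a) *\<^sub>R (g y - g 0)" for y
  have "orthogonal_transformation h"
    unfolding orthogonal_transformation_isometry
  proof (intro conjI allI)
    fix x y
    have "dist (h x) (h y) = norm ((1 / a) *\<^sub>R (g x - g y))"
      unfolding h_def dist_norm by (simp add: scaleR_diff_right)
    then show "dist (h x) (h y) = dist x y" using sim[of x y] a by (simp add: dist_norm)
  qed (simp add: h_def)
  then have "h ` ball x r = ball (h x) r" by (rule image_orthogonal_transformation_ball)
  moreover have "g = (\<lambda>z. g 0 + a *\<^sub>R z) \<circ> h" using a by (auto simp: h_def)
  ultimately have "g ` ball x r = (\<lambda>z. g 0 + a *\<^sub>R z) ` ball (h x) r"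
    by (metis image_comp)
  also have "\<dots> = (+) (g 0) ` (*\<^sub>R) a ` ball (h x) r" unfolding image_image ..
  also have "\<dots> = ball (g 0 + a *\<^sub>R h x) (a * r)"
    unfolding ball_translation using a by (simp add: ball_scale)
  also have "\<dots> = ball (g x) (a * r)" using a by (simp add: h_def)
  finally show ?thesis .
qed

text \<open>Right continuity of the power function, also at 0 because \<open>0 < t\<close>. It
  allows the sets of a cover to be enlarged to open sets of positive size at an arbitrarily small
  cost.\<close>

lemma exists_larger_powr_close:
  fixes d t e b :: real
  assumes "0 \<le> d" "d < b" "0 < t" "0 < e"
  obtains r where "d < r" "r < b" "r powr t \<le> d powr t + e"
proof -
  have "((\<lambda>r. r powr t) \<longlongrightarrow> d powr t) (at_right d)"
    using assms by (intro tendsto_powr') (auto intro!: tendsto_intros simp: eventually_at_right_field intro: exI[of _ b])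
  then have "\<forall>\<^sub>F r in at_right d. r powr t < d powr t + e"
    by (rule order_tendstoD) (use assms in simp)
  moreover have "\<forall>\<^sub>F r in at_right d. r < b" "\<forall>\<^sub>F r in at_right d. d < r"
    using assms by (auto simp: eventually_at_right_field intro: exI[of _ b])
  ultimately have "\<forall>\<^sub>F r in at_right d. r powr t < d powr t + e \<and> r < b \<and> d < r"
    by eventually_elim auto
  then show ?thesis using that eventually_happens[of _ "at_right d"] by (force simp: trivial_limit_at_right_real)
qed

section \<open>Hausdorff null sets through covers\<close>

lemma hausdorff_measure_eq_0I:
  assumes "\<And>\<delta> e. 0 < \<delta> \<Longrightarrow> 0 < e \<Longrightarrow> hausdorff_premeasure h F \<delta> \<le> ennreal e"
  shows "hausdorff_measure h F = 0"
proof -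
  have "hausdorff_premeasure h F \<delta> = 0" if "0 < \<delta>" for \<delta>
    by (rule antisym[OF ennreal_le_epsilon]) (use assms[OF that] in auto)
  then show ?thesis unfolding hausdorff_measure_eq_SUP by (auto simp: SUP_eq_const)
qed

lemma small_cover_of_hausdorff_measure_eq_0:
  assumes "hausdorff_measure h F = 0" "0 < \<delta>" "0 < e"
  obtains U :: "nat \<Rightarrow> 'a::metric_space set" where "F \<subseteq> (\<Union>i. U i)"
    "\<And>i. bounded (U i)" "\<And>i. diameter (U i) \<le> \<delta>" "(\<Sum>i. ennreal (h (diameter (U i)))) < ennreal e"
proof -
  have "hausdorff_premeasure h F \<delta> \<le> hausdorff_measure h F"
    unfolding hausdorff_measure_eq_SUP using assms(2) by (intro SUP_upper) simp
  then have "hausdorff_premeasure h F \<delta> < ennreal e" using assms by simp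
  then show ?thesis unfolding hausdorff_premeasure_def Inf_less_iff using that by blast
qed

text \<open>The common ratio of the system at \<open>l\<close> is represented by
  \<open>c l 1\<close>, as index 1 is available for every parameter.\<close>

locale homogeneous_rifs = rifs \<mu> \<Lambda> N f c \<Delta>
  for \<mu> :: "(real ^ 'k) measure" and \<Lambda> N and f :: "real ^ 'k \<Rightarrow> nat \<Rightarrow> real ^ 'd \<Rightarrow> real ^ 'd" and c \<Delta> +
  fixes cmin cmax :: real
  assumes cmin_pos: "0 < cmin" and cmax_less_1: "cmax < 1"
    and homogeneous: "\<And>l i. l \<in> \<Lambda> \<Longrightarrow> i \<in> {1..N l} \<Longrightarrow> c l i = c l 1"
    and c_bounds: "\<And>l. l \<in> \<Lambda> \<Longrightarrow> c l 1 \<in> {cmin..cmax}"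
begin

text \<open>Words are extensional functions, \<open>undefined\<close> from position \<open>k\<close>
  on, so that each choice of \<open>k\<close> letters is counted exactly once.\<close>

definition words :: "(nat \<Rightarrow> real ^ 'k) \<Rightarrow> nat \<Rightarrow> (nat \<Rightarrow> nat) set" where
  "words \<omega> k = (\<Pi>\<^sub>E i\<in>{..<k}. {1..N (\<omega> i)})"

definition scale :: "(nat \<Rightarrow> real ^ 'k) \<Rightarrow> nat \<Rightarrow> real" where
  "scale \<omega> k = (\<Prod>i<k. c (\<omega> i) 1)"

lemma cyl_map_cong: "(\<And>i. i < k \<Longrightarrow> j i = j' i) \<Longrightarrow> cyl_map f \<omega> j k = cyl_map f \<omega> j' k"
  by (induction k) auto

lemma cyl_map_restrict: "k \<le> n \<Longrightarrow> cyl_map f \<omega> (restrict j {..<n}) k = cyl_map f \<omega> j k"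
  by (rule cyl_map_cong) auto

section \<open>Cylinders for a fixed parameter sequence\<close>

context
  fixes \<omega> :: "nat \<Rightarrow> real ^ 'k"
  assumes \<omega>: "\<And>i. \<omega> i \<in> \<Lambda>"
begin

lemma finite_words: "finite (words \<omega> k)"
  unfolding words_def by (intro finite_PiE) auto

lemma card_words: "card (words \<omega> k) = (\<Prod>i<k. N (\<omega> i))"
  unfolding words_def by (subst card_PiE) auto

lemma N_pos: "0 < N (\<omega> i)"
  using N_ge_1[OF \<omega>[of i]] by simp

lemma card_words_pos: "0 < card (words \<omega> k)"
  unfolding card_words using N_pos by (intro prod_pos) auto

lemma scale_pos: "0 < scale \<omega> k"
  unfolding scale_def using c_bounds[OF \<omega>] cmin_pos by (intro prod_pos) (auto intro: less_le_trans)

lemma scale_le: "scale \<omega> k \<le> cmax ^ k"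
proof -
  have "scale \<omega> k \<le> (\<Prod>i<k. cmax)"
    unfolding scale_def using c_bounds[OF \<omega>] cmin_pos
    by (intro prod_mono) (auto intro: order_trans less_imp_le)
  then show ?thesis by simp
qed

lemma scale_tendsto_0: "scale \<omega> \<longlonglongrightarrow> 0"
proof (rule tendsto_sandwich[where f="\<lambda>_. 0" and h="\<lambda>k. cmax ^ k"])
  show "(\<lambda>k. cmax ^ k) \<longlonglongrightarrow> 0"
    using cmax_less_1 c_bounds[OF \<omega>[of 0]] cmin_pos by (intro LIMSEQ_realpow_zero) auto
  show "\<forall>\<^sub>F k in sequentially. scale \<omega> k \<le> cmax ^ k"
    using scale_le by simp
  show "\<forall>\<^sub>F k in sequentially. 0 \<le> scale \<omega> k"
    using scale_pos by (simp add: less_imp_le)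
qed simp

text \<open>Take the first level at which the scale is at most \<open>r\<close>. It is not level 0,
  since \<open>r < 1\<close>; the preceding scale exceeds \<open>r\<close>, and one step multiplies
  it by at least \<open>cmin\<close>.\<close>

lemma comparable_scale:
  assumes "0 < r" "r < 1"
  obtains k where "scale \<omega> k \<le> r" "cmin * r \<le> scale \<omega> k"
proof -
  have "\<exists>k. scale \<omega> k \<le> r"
    using order_tendstoD(2)[OF scale_tendsto_0 assms(1)] by (auto simp: eventually_sequentially intro: less_imp_le)
  define k where "k = (LEAST k. scale \<omega> k \<le> r)"
  have k: "scale \<omega> k \<le> r" unfolding k_def by (rule LeastI_ex) fact
  have "k \<noteq> 0"
  proof
    assume "k = 0"
    with k assms show False by (simp add: scale_def)
  qed
  then obtain k' where k': "k = Suc k'" using not0_implies_Suc by blast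
  have "\<not> scale \<omega> k' \<le> r" using not_less_Least[of k' "\<lambda>k. scale \<omega> k \<le> r"] k' by (simp add: k_def)
  then have "cmin * r \<le> c (\<omega> k') 1 * scale \<omega> k'"
    using c_bounds[OF \<omega>[of k']] cmin_pos assms by (intro mult_mono) auto
  also have "\<dots> = scale \<omega> k" by (simp add: scale_def k' mult.commute)
  finally show ?thesis using that k by blast
qed

lemma dist_cyl_map:
  "(\<And>i. i < k \<Longrightarrow> j i \<in> {1..N (\<omega> i)}) \<Longrightarrow>
    dist (cyl_map f \<omega> j k x) (cyl_map f \<omega> j k y) = scale \<omega> k * dist x y"
proof (induction k arbitrary: x y)
  case 0
  then show ?case by (simp add: scale_def)
next
  case (Suc k)
  have "dist (f (\<omega> k) (j k) x) (f (\<omega> k) (j k) y) = c (\<omega> k) 1 * dist x y"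
    using similarity[OF \<omega>, of "j k" k x y] homogeneous[OF \<omega>, of "j k" k] Suc.prems[of k]
    by (simp add: dist_norm)
  with Suc show ?case by (simp add: scale_def)
qed

lemma continuous_on_cyl_map:
  assumes "\<And>i. i < k \<Longrightarrow> j i \<in> {1..N (\<omega> i)}"
  shows "continuous_on S (cyl_map f \<omega> j k)"
proof (rule lipschitz_on_continuous_on)
  show "(scale \<omega> k)-lipschitz_on S (cyl_map f \<omega> j k)"
    using dist_cyl_map[OF assms] scale_pos[of k] by (intro lipschitz_onI) auto
qed

lemma cyl_map_image_antimono:
  assumes S: "\<And>l i. l \<in> \<Lambda> \<Longrightarrow> i \<in> {1..N l} \<Longrightarrow> f l i ` S \<subseteq> S"
    and j: "\<And>i. i < n \<Longrightarrow> j i \<in> {1..N (\<omega> i)}" and "k \<le> n"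
  shows "cyl_map f \<omega> j n ` S \<subseteq> cyl_map f \<omega> j k ` S"
  using \<open>k \<le> n\<close> j
proof (induction rule: dec_induct)
  case (step n)
  have "cyl_map f \<omega> j (Suc n) ` S = cyl_map f \<omega> j n ` (f (\<omega> n) (j n) ` S)" by (simp add: image_comp)
  also have "\<dots> \<subseteq> cyl_map f \<omega> j n ` S" using S[OF \<omega>, of "j n" n] step.prems[of n] by (intro image_mono) auto
  finally show ?case using step by fastforce
qed simp

text \<open>At the first letter where the words differ, the two images come from disjoint images of
  \<open>S\<close> under one and the same injective prefix map; further letters only shrink
  them.\<close>

lemma cyl_images_disjoint:
  assumes S: "\<And>l i. l \<in> \<Lambda> \<Longrightarrow> i \<in> {1..N l} \<Longrightarrow> f l i ` S \<subseteq> S"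
    and disj: "\<And>l i j. l \<in> \<Lambda> \<Longrightarrow> i \<in> {1..N l} \<Longrightarrow> j \<in> {1..N l} \<Longrightarrow> i \<noteq> j \<Longrightarrow> f l i ` S \<inter> f l j ` S = {}"
  shows "w \<in> words \<omega> k \<Longrightarrow> w' \<in> words \<omega> k \<Longrightarrow> w \<noteq> w' \<Longrightarrow>
    cyl_map f \<omega> w k ` S \<inter> cyl_map f \<omega> w' k ` S = {}"
proof -
  assume w: "w \<in> words \<omega> k" "w' \<in> words \<omega> k" "w \<noteq> w'"
  then have v: "w i \<in> {1..N (\<omega> i)}" "w' i \<in> {1..N (\<omega> i)}" if "i < k" for i
    using that unfolding words_def by (auto dest!: PiE_mem)
  from w have "\<exists>i<k. w i \<noteq> w' i"
    unfolding words_def by (metis PiE_ext lessThan_iff)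
  then obtain i where i: "i < k" "w i \<noteq> w' i" "\<And>i'. i' < i \<Longrightarrow> w i' = w' i'"
    using exists_least_iff[of "\<lambda>i. i < k \<and> w i \<noteq> w' i"] by (metis less_trans)
  have eq: "cyl_map f \<omega> w' i = cyl_map f \<omega> w i" using i by (intro cyl_map_cong) auto
  have inj: "inj (cyl_map f \<omega> w i)"
  proof (rule injI)
    fix x y assume "cyl_map f \<omega> w i x = cyl_map f \<omega> w i y"
    then have "scale \<omega> i * dist x y = 0"
      using dist_cyl_map[of i w x y] v i(1) by simp
    then show "x = y" using scale_pos[of i] by simp
  qed
  have "cyl_map f \<omega> w k ` S \<subseteq> cyl_map f \<omega> w (Suc i) ` S" "cyl_map f \<omega> w' k ` S \<subseteq> cyl_map f \<omega> w' (Suc i) ` S"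
    using i(1) v by (intro cyl_map_image_antimono[OF S] Suc_leI; simp)+
  moreover have "cyl_map f \<omega> w (Suc i) ` S \<inter> cyl_map f \<omega> w' (Suc i) ` S =
     cyl_map f \<omega> w i ` (f (\<omega> i) (w i) ` S \<inter> f (\<omega> i) (w' i) ` S)"
    unfolding image_Int[OF inj] by (simp add: eq image_comp)
  moreover have "\<dots> = {}" using disj[OF \<omega>, of "w i" i "w' i"] v i by simp
  ultimately show ?thesis by blast
qed

lemma attractor_subset: "attractor N f \<Delta> \<omega> \<subseteq> (\<Union>w\<in>words \<omega> k. cyl_map f \<omega> w k ` \<Delta>)"
proof
  fix x assume "x \<in> attractor N f \<Delta> \<omega>"
  \<comment> \<open>Level \<open>Suc k\<close> is used because the intersection starts at level 1;
    this includes the case \<open>k = 0\<close>.\<close>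
  then obtain j where j: "\<forall>i<Suc k. j i \<in> {1..N (\<omega> i)}" "x \<in> cyl_map f \<omega> j (Suc k) ` \<Delta>"
    unfolding attractor_def by (auto dest!: bspec[of _ _ "Suc k"] simp del: cyl_map.simps)
  then have "x \<in> cyl_map f \<omega> j k ` \<Delta>"
    by (intro subsetD[OF cyl_map_image_antimono[OF Delta_invariant] j(2)]) auto
  moreover have "restrict j {..<k} \<in> words \<omega> k" using j by (auto simp: words_def)
  ultimately show "x \<in> (\<Union>w\<in>words \<omega> k. cyl_map f \<omega> w k ` \<Delta>)"
    by (intro UN_I[of "restrict j {..<k}"]) (simp_all add: cyl_map_restrict)
qed

text \<open>Passing from infinite sequences of letters to finite words turns every union into a
  finite one, from which compactness follows.\<close>

lemma attractor_eq: "attractor N f \<Delta> \<omega> = (\<Inter>k\<in>{1..}. \<Union>w\<in>words \<omega> k. cyl_map f \<omega> w k ` \<Delta>)"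
proof
  show "attractor N f \<Delta> \<omega> \<subseteq> (\<Inter>k\<in>{1..}. \<Union>w\<in>words \<omega> k. cyl_map f \<omega> w k ` \<Delta>)"
    using attractor_subset by blast
  have "words \<omega> k \<subseteq> {j. \<forall>i<k. j i \<in> {1..N (\<omega> i)}}" for k
    unfolding words_def by (auto dest!: PiE_mem)
  then show "(\<Inter>k\<in>{1..}. \<Union>w\<in>words \<omega> k. cyl_map f \<omega> w k ` \<Delta>) \<subseteq> attractor N f \<Delta> \<omega>"
    unfolding attractor_def by (intro INF_mono' UN_mono) auto
qed

lemma wordsD: "w \<in> words \<omega> k \<Longrightarrow> i < k \<Longrightarrow> w i \<in> {1..N (\<omega> i)}"
  unfolding words_def by (auto dest!: PiE_mem)

section \<open>Compactness and points in nested cylinders\<close>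

lemma compact_attractor: "compact (attractor N f \<Delta> \<omega>)"
proof -
  have "compact (\<Union>w\<in>words \<omega> k. cyl_map f \<omega> w k ` \<Delta>)" for k
    using Delta(1) wordsD
    by (intro compact_UN finite_words compact_continuous_image continuous_on_cyl_map) auto
  then show ?thesis unfolding attractor_eq by (intro compact_Inter) auto
qed

text \<open>Continuing the word by the letter 1 gives a decreasing sequence of non-empty compact
  cylinders, whose intersection supplies the point. One point serves all prefixes, which allows sets
  of different sizes to be compared at different levels.\<close>

lemma attractor_meets_cylinder:
  assumes w: "w \<in> words \<omega> n"
  obtains x where "x \<in> attractor N f \<Delta> \<omega>" "\<And>k. k \<le> n \<Longrightarrow> x \<in> cyl_map f \<omega> w k ` \<Delta>"
proof -
  define j where "j i = (if i < n then w i else 1)" for i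
  have j: "j i \<in> {1..N (\<omega> i)}" for i
    using wordsD[OF w, of i] N_ge_1[OF \<omega>[of i]] by (auto simp: j_def)
  have "\<Inter> (range (\<lambda>k. cyl_map f \<omega> j k ` \<Delta>)) \<noteq> {}"
  proof (rule compact_nest)
    show "compact (cyl_map f \<omega> j k ` \<Delta>)" for k
      using Delta(1) j by (intro compact_continuous_image continuous_on_cyl_map)
    show "cyl_map f \<omega> j k' ` \<Delta> \<subseteq> cyl_map f \<omega> j k ` \<Delta>" if "k \<le> k'" for k k'
      using that j by (intro cyl_map_image_antimono Delta_invariant)
  qed (use Delta(2) in simp)
  then obtain x where x: "\<And>k. x \<in> cyl_map f \<omega> j k ` \<Delta>" by blast
  show ?thesis
  proof
    show "x \<in> attractor N f \<Delta> \<omega>" using x j unfolding attractor_def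
      by (intro INT_I UN_I[of j]) simp_all
    show "x \<in> cyl_map f \<omega> w k ` \<Delta>" if "k \<le> n" for k
    proof -
      have "cyl_map f \<omega> w k = cyl_map f \<omega> j k" using that by (intro cyl_map_cong) (auto simp: j_def)
      with x[of k] show ?thesis by simp
    qed
  qed
qed

text \<open>All words of length \<open>k\<close> have the same number of extensions to length
  \<open>n\<close>. The share of words of length \<open>n\<close> passing through \<open>W\<close>
  therefore plays the role of the natural measure of the cylinders in \<open>W\<close>.\<close>

lemma card_extensions:
  assumes "W \<subseteq> words \<omega> k" "k \<le> n"
  shows "real (card {w \<in> words \<omega> n. restrict w {..<k} \<in> W}) * card (words \<omega> k) = real (card W) * card (words \<omega> n)"
proof -
  have "bij_betw (\<lambda>w. (restrict w {..<k}, restrict w {k..<n})) {w \<in> words \<omega> n. restrict w {..<k} \<in> W}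
      (W \<times> (\<Pi>\<^sub>E i\<in>{k..<n}. {1..N (\<omega> i)}))"
  proof (rule bij_betwI[where g="\<lambda>(u, v) i. if i < k then u i else v i"])
    show "(\<lambda>w. (restrict w {..<k}, restrict w {k..<n})) \<in> {w \<in> words \<omega> n. restrict w {..<k} \<in> W} \<rightarrow> W \<times> (\<Pi>\<^sub>E i\<in>{k..<n}. {1..N (\<omega> i)})"
      by (auto dest: wordsD)
    have *: "restrict (\<lambda>i. if i < k then u i else v i) {..<k} = u" if "u \<in> W" for u v :: "nat \<Rightarrow> nat"
      using that assms(1) unfolding words_def by (auto simp: fun_eq_iff dest!: subsetD PiE_arb)
    show "(\<lambda>(u, v) i. if i < k then u i else v i) \<in> W \<times> (\<Pi>\<^sub>E i\<in>{k..<n}. {1..N (\<omega> i)}) \<rightarrow> {w \<in> words \<omega> n. restrict w {..<k} \<in> W}"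
    proof (clarsimp simp: *)
      fix u v assume u: "u \<in> W" and v: "v \<in> (\<Pi>\<^sub>E i\<in>{k..<n}. {Suc 0..N (\<omega> i)})"
      show "(\<lambda>i. if i < k then u i else v i) \<in> words \<omega> n"
        unfolding words_def
      proof (rule PiE_I)
        fix i assume "i \<in> {..<n}"
        then show "(if i < k then u i else v i) \<in> {1..N (\<omega> i)}"
          using wordsD[of u k i] u assms(1) PiE_mem[OF v, of i] by auto
      next
        fix i assume "i \<notin> {..<n}"
        then show "(if i < k then u i else v i) = undefined"
          using PiE_arb[OF v, of i] assms(2) by auto
      qed
    qed
    show "(\<lambda>(u, v) i. if i < k then u i else v i) (restrict w {..<k}, restrict w {k..<n}) = w"
      if "w \<in> {w \<in> words \<omega> n. restrict w {..<k} \<in> W}" for w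
      using that assms(2) unfolding words_def by (auto simp: fun_eq_iff dest!: PiE_arb)
    show "(restrict ((\<lambda>(u, v) i. if i < k then u i else v i) p) {..<k}, restrict ((\<lambda>(u, v) i. if i < k then u i else v i) p) {k..<n}) = p"
      if p: "p \<in> W \<times> (\<Pi>\<^sub>E i\<in>{k..<n}. {1..N (\<omega> i)})" for p
    proof -
      obtain u v where uv: "p = (u, v)" "u \<in> W" "v \<in> (\<Pi>\<^sub>E i\<in>{k..<n}. {1..N (\<omega> i)})" using p by auto
      have "restrict (\<lambda>i. if i < k then u i else v i) {k..<n} = v"
        using uv(3) by (auto simp: fun_eq_iff dest!: PiE_arb)
      then show ?thesis using *[OF uv(2), of v] by (simp add: uv(1))
    qed
  qed
  then have "card {w \<in> words \<omega> n. restrict w {..<k} \<in> W} = card W * (\<Prod>i\<in>{k..<n}. N (\<omega> i))"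
    by (simp add: bij_betw_same_card card_cartesian_product card_PiE)
  moreover have "(\<Prod>i<n. N (\<omega> i)) = (\<Prod>i<k. N (\<omega> i)) * (\<Prod>i\<in>{k..<n}. N (\<omega> i))"
    using prod.atLeastLessThan_concat[of 0 k n "\<lambda>i. N (\<omega> i)"] assms(2) by (simp add: lessThan_atLeast0)
  ultimately show ?thesis by (simp add: card_words)
qed

end

text \<open>Volume comparison: the images of a ball inside the open set are disjoint balls of radius
  R \<rho>, with R the scale, and those whose cylinder meets \<open>V\<close> lie in one ball of
  radius r (1 + D + \<rho>). As R is at least \<open>cmin * r\<close>, the number of balls is at
  most \<open>Q ^ n\<close>, whatever the sequence, the level and the size.\<close>

lemma card_cylinders_meeting_le:
  assumes U: "UOSC \<Lambda> N f"
  shows "\<exists>M>0. \<forall>\<omega> k r V. (\<forall>i. \<omega> i \<in> \<Lambda>) \<longrightarrow> 0 < r \<longrightarrow> scale \<omega> k \<le> r \<longrightarrow> cmin * r \<le> scale \<omega> k \<longrightarrow>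
       (\<forall>x\<in>V. \<forall>y\<in>V. dist x y \<le> r) \<longrightarrow>
       real (card {w \<in> words \<omega> k. cyl_map f \<omega> w k ` \<Delta> \<inter> V \<noteq> {}}) \<le> M"
proof -
  from U obtain O' where O': "O' \<noteq> {}" "open O'"
    "\<And>l i. l \<in> \<Lambda> \<Longrightarrow> i \<in> {1..N l} \<Longrightarrow> f l i ` O' \<subseteq> O'"
    "\<And>l i j. l \<in> \<Lambda> \<Longrightarrow> i \<in> {1..N l} \<Longrightarrow> j \<in> {1..N l} \<Longrightarrow> i \<noteq> j \<Longrightarrow> f l i ` O' \<inter> f l j ` O' = {}"
    unfolding UOSC_def by metis
  from O'(1,2) obtain x0 \<rho> where \<rho>: "0 < \<rho>" "ball x0 \<rho> \<subseteq> O'"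
    by (meson ex_in_conv openE)
  have "bounded (insert x0 \<Delta>)" using compact_imp_bounded[OF Delta(1)] by simp
  \<comment> \<open>\<open>x0\<close> comes from the open set and may lie outside
    \<open>\<Delta>\<close>; up to scale, \<open>D\<close> bounds the distance from a point of a
    cylinder to the centre of its ball.\<close>
  then obtain D where D: "\<And>p. p \<in> \<Delta> \<Longrightarrow> dist p x0 \<le> D"
    unfolding bounded_any_center[of _ x0] by (auto simp: dist_commute)
  have D0: "0 \<le> D" using D Delta(2) zero_le_dist order_trans by blast
  define n where "n = CARD('d)"
  define Q where "Q = (1 + D + \<rho>) / (cmin * \<rho>)"
  have Q: "0 < Q" using D0 \<rho> cmin_pos by (simp add: Q_def)
  show ?thesis
  proof (intro exI[of _ "Q ^ n"] conjI allI impI)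
    show "0 < Q ^ n" using Q by simp
    fix \<omega> :: "nat \<Rightarrow> real ^ 'k" and k r and V :: "(real ^ 'd) set"
    assume "\<forall>i. \<omega> i \<in> \<Lambda>" and r: "0 < r" "scale \<omega> k \<le> r" "cmin * r \<le> scale \<omega> k"
      and V: "\<forall>x\<in>V. \<forall>y\<in>V. dist x y \<le> r"
    then have \<omega>: "\<And>i. \<omega> i \<in> \<Lambda>" by blast
    define W where "W = {w \<in> words \<omega> k. cyl_map f \<omega> w k ` \<Delta> \<inter> V \<noteq> {}}"
    define R where "R = scale \<omega> k"
    define B where "B w = ball (cyl_map f \<omega> w k x0) (R * \<rho>)" for w
    have R: "0 < R" "R \<le> r" "cmin * r \<le> R" using scale_pos[OF \<omega>] r by (auto simp: R_def)
    have finW: "finite W" unfolding W_def using finite_words[OF \<omega>] by simp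
    have img: "B w = cyl_map f \<omega> w k ` ball x0 \<rho>" if "w \<in> words \<omega> k" for w
      unfolding B_def R_def
      by (rule similarity_image_ball[symmetric]) (auto intro!: dist_cyl_map \<omega> scale_pos wordsD that)
    have disj: "disjoint_family_on B W"
      unfolding disjoint_family_on_def
    proof (intro ballI impI)
      fix w w' assume "w \<in> W" "w' \<in> W" "w \<noteq> w'"
      then have w: "w \<in> words \<omega> k" "w' \<in> words \<omega> k" "w \<noteq> w'" by (auto simp: W_def)
      then have "cyl_map f \<omega> w k ` O' \<inter> cyl_map f \<omega> w' k ` O' = {}"
        by (intro cyl_images_disjoint[OF \<omega> O'(3,4)])
      moreover have "B w \<subseteq> cyl_map f \<omega> w k ` O'" "B w' \<subseteq> cyl_map f \<omega> w' k ` O'"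
        unfolding img[OF w(1)] img[OF w(2)] by (intro image_mono \<rho>(2))+
      ultimately show "B w \<inter> B w' = {}" by (blast dest: subsetD)
    qed
    have "real (card W) \<le> Q ^ n"
    proof (cases "W = {}")
      case False
      then obtain u where u: "u \<in> V" by (auto simp: W_def)
      have sub: "B w \<subseteq> ball u (r * (1 + D + \<rho>))" if wW: "w \<in> W" for w
      proof
        fix y assume y: "y \<in> B w"
        obtain p where p: "p \<in> \<Delta>" "cyl_map f \<omega> w k p \<in> V" using wW unfolding W_def by blast
        have "dist u y \<le> dist u (cyl_map f \<omega> w k p) + dist (cyl_map f \<omega> w k p) (cyl_map f \<omega> w k x0)
            + dist (cyl_map f \<omega> w k x0) y" by metric
        also have "dist u (cyl_map f \<omega> w k p) \<le> r" using V u p by blast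
        also have "dist (cyl_map f \<omega> w k p) (cyl_map f \<omega> w k x0) = R * dist p x0"
          unfolding R_def using wW by (intro dist_cyl_map \<omega> wordsD) (auto simp: W_def)
        also have "R * dist p x0 \<le> r * D" using R D[OF p(1)] r by (intro mult_mono) auto
        also have "dist (cyl_map f \<omega> w k x0) y < R * \<rho>" using y by (simp add: B_def)
        also have "R * \<rho> \<le> r * \<rho>" using R \<rho> by simp
        finally show "y \<in> ball u (r * (1 + D + \<rho>))" by (simp add: algebra_simps)
      qed
      have pos: "0 \<le> r * (1 + D + \<rho>)" using r D0 \<rho> by simp
      have "real (card W) * (unit_ball_vol (real n) * (R * \<rho>) ^ n) = (\<Sum>w\<in>W. measure lborel (B w))"
        using R \<rho> by (simp add: B_def content_ball n_def)
      also have "\<dots> = measure lborel (\<Union>w\<in>W. B w)"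
        by (rule measure_finite_Union[symmetric, OF finW _ disj])
           (use emeasure_lborel_ball_finite[where ?'a="real ^ 'd"] in \<open>auto simp: B_def less_top\<close>)
      also have "\<dots> \<le> measure lborel (ball u (r * (1 + D + \<rho>)))"
        using sub finW by (intro measure_mono_fmeasurable sets.finite_UN UN_least fmeasurableI emeasure_lborel_ball_finite)
          (auto simp: B_def)
      also have "\<dots> = unit_ball_vol (real n) * (r * (1 + D + \<rho>)) ^ n"
        using pos by (simp add: content_ball n_def)
      finally have "unit_ball_vol (real n) * (real (card W) * (R * \<rho>) ^ n) \<le> unit_ball_vol (real n) * (r * (1 + D + \<rho>)) ^ n"
        by (simp add: mult_ac)
      then have 1: "real (card W) * (R * \<rho>) ^ n \<le> (r * (1 + D + \<rho>)) ^ n"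
        by (rule mult_left_le_imp_le) simp
      have "r * (1 + D + \<rho>) = Q * (cmin * r * \<rho>)" using cmin_pos \<rho> by (simp add: Q_def field_simps)
      also have "\<dots> \<le> Q * (R * \<rho>)" using R Q \<rho> by (intro mult_left_mono mult_right_mono) auto
      finally have "(r * (1 + D + \<rho>)) ^ n \<le> (Q * (R * \<rho>)) ^ n" using pos by (intro power_mono)
      also have "\<dots> = Q ^ n * (R * \<rho>) ^ n" by (simp add: power_mult_distrib)
      finally have "real (card W) * (R * \<rho>) ^ n \<le> Q ^ n * (R * \<rho>) ^ n" using 1 by simp
      then show ?thesis by (rule mult_right_le_imp_le) (use R \<rho> in simp)
    qed (use Q in simp)
    then show "real (card {w \<in> words \<omega> k. cyl_map f \<omega> w k ` \<Delta> \<inter> V \<noteq> {}}) \<le> Q ^ n"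
      by (simp only: W_def)
  qed
qed

text \<open>A mass distribution argument by counting words. A covering set of size r meets at most
  \<open>M\<close> cylinders of comparable size, so at most a share M C r^t of all long words passes
  through it. The shares add up to at least 1, which bounds the sum of the r^t from below.\<close>

lemma hausdorff_measure_attractor_pos:
  assumes U: "UOSC \<Lambda> N f" and \<omega>: "\<And>i. \<omega> i \<in> \<Lambda>" and t: "0 < t" and C: "0 < C"
    and growth: "\<And>k. 1 \<le> C * (real (card (words \<omega> k)) * scale \<omega> k powr t)"
  shows "hausdorff_measure (\<lambda>x. x powr t) (attractor N f \<Delta> \<omega>) \<noteq> 0"
proof
  assume 0: "hausdorff_measure (\<lambda>x. x powr t) (attractor N f \<Delta> \<omega>) = 0"
  obtain M where M: "0 < M" and "\<forall>\<omega> k r V. (\<forall>i. \<omega> i \<in> \<Lambda>) \<longrightarrow> 0 < r \<longrightarrow> scale \<omega> k \<le> r \<longrightarrow> cmin * r \<le> scale \<omega> k \<longrightarrow>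
       (\<forall>x\<in>V. \<forall>y\<in>V. dist x y \<le> r) \<longrightarrow>
       real (card {w \<in> words \<omega> k. cyl_map f \<omega> w k ` \<Delta> \<inter> V \<noteq> {}}) \<le> M"
    using card_cylinders_meeting_le[OF U] by blast
  note M_bound = this(2)[rule_format, OF \<omega>]
  \<comment> \<open>If the sizes cost less than \<open>2 * e\<close> in total, the shares of words
    add up to less than \<open>1/2\<close>.\<close>
  define e where "e = 1 / (4 * M * C)"
  have e: "0 < e" using M C by (simp add: e_def)
  \<comment> \<open>The diameter bound \<open>1/2\<close> leaves room for enlarged sizes below 1, as
    needed to find a comparable level.\<close>
  obtain S where S: "attractor N f \<Delta> \<omega> \<subseteq> (\<Union>i. S i)" "\<And>i. bounded (S i)" "\<And>i. diameter (S i) \<le> 1/2"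
      "(\<Sum>i. ennreal (diameter (S i) powr t)) < ennreal e"
    by (rule small_cover_of_hausdorff_measure_eq_0[OF 0, of "1/2" e]) (use e in auto)
  have "\<exists>r. diameter (S i) < r \<and> r < 1 \<and> r powr t \<le> diameter (S i) powr t + e * (1/2) ^ Suc i" for i
    by (rule exists_larger_powr_close[of "diameter (S i)" 1 t "e * (1/2) ^ Suc i"])
       (use diameter_ge_0[OF S(2)[of i]] S(3)[of i] t e in auto)
  then obtain r where r: "\<And>i. diameter (S i) < r i" "\<And>i. r i < 1"
      "\<And>i. r i powr t \<le> diameter (S i) powr t + e * (1/2) ^ Suc i" by metis
  have rpos: "0 < r i" for i using r(1)[of i] diameter_ge_0[OF S(2)[of i]] by linarith
  \<comment> \<open>Neighbourhoods of half the slack are open and keep mutual distances at most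
    \<open>r i\<close>. Compactness then leaves finitely many of them, so that one level
    \<open>n\<close> dominates all levels \<open>k i\<close> in use.\<close>
  define V where "V i = (\<Union>x\<in>S i. ball x ((r i - diameter (S i)) / 2))" for i
  have V_open: "open (V i)" for i unfolding V_def by (intro open_UN ballI open_ball)
  have V_dist: "dist x y \<le> r i" if xV: "x \<in> V i" and yV: "y \<in> V i" for i x y
  proof -
    obtain x' y' where xy: "x' \<in> S i" "y' \<in> S i" "dist x' x < (r i - diameter (S i)) / 2" "dist y' y < (r i - diameter (S i)) / 2"
      using xV yV unfolding V_def by (auto simp only: UN_iff mem_ball)
    have "dist x y \<le> dist x' x + dist x' y' + dist y' y" by metric
    then show ?thesis using xy diameter_bounded_bound[OF S(2)[of i] xy(1,2)] by argo
  qed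
  have "S i \<subseteq> V i" for i using r(1)[of i] by (force simp: V_def)
  then have cover: "attractor N f \<Delta> \<omega> \<subseteq> (\<Union>i\<in>UNIV. V i)"
    by (intro order_trans[OF S(1) UN_mono]) simp_all
  obtain I where "I \<subseteq> UNIV" and I: "finite I" "attractor N f \<Delta> \<omega> \<subseteq> (\<Union>i\<in>I. V i)"
    by (rule compactE_image[OF compact_attractor[OF \<omega>] V_open cover])
  have "\<exists>k. scale \<omega> k \<le> r i \<and> cmin * r i \<le> scale \<omega> k" for i
    by (rule comparable_scale[of \<omega> "r i", OF \<omega> rpos[of i] r(2)[of i]]) blast
  then obtain k where k: "\<And>i. scale \<omega> (k i) \<le> r i" "\<And>i. cmin * r i \<le> scale \<omega> (k i)" by metis
  obtain n where n: "\<And>i. i \<in> I \<Longrightarrow> k i \<le> n"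
    using finite_nat_set_iff_bounded_le[of "k ` I"] I(1) by auto
  define W where "W i = {w \<in> words \<omega> (k i). cyl_map f \<omega> w (k i) ` \<Delta> \<inter> V i \<noteq> {}}" for i
  define E where "E i = {w \<in> words \<omega> n. restrict w {..<k i} \<in> W i}" for i
  define P where "P j = real (card (words \<omega> j))" for j
  have P: "0 < P j" for j using card_words_pos[OF \<omega>] by (simp add: P_def)
  have "words \<omega> n \<subseteq> (\<Union>i\<in>I. E i)"
  proof
    fix w assume w: "w \<in> words \<omega> n"
    obtain x where x: "x \<in> attractor N f \<Delta> \<omega>" "\<And>k. k \<le> n \<Longrightarrow> x \<in> cyl_map f \<omega> w k ` \<Delta>"
      using attractor_meets_cylinder[OF \<omega> w] by metis
    then obtain i where i: "i \<in> I" "x \<in> V i" using I(2) by blast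
    have "restrict w {..<k i} \<in> words \<omega> (k i)"
      using wordsD[OF \<omega> w] n[OF i(1)] unfolding words_def by (intro restrict_PiE_iff[THEN iffD2]) auto
    moreover have "x \<in> cyl_map f \<omega> (restrict w {..<k i}) (k i) ` \<Delta>"
      using x(2)[OF n[OF i(1)]] by (simp add: cyl_map_restrict)
    ultimately show "w \<in> (\<Union>i\<in>I. E i)" using i w by (auto simp: E_def W_def)
  qed
  then have "P n \<le> real (card (\<Union>i\<in>I. E i))"
    unfolding P_def E_def using I(1) finite_words[OF \<omega>] by (intro of_nat_mono card_mono) auto
  also have "\<dots> \<le> real (\<Sum>i\<in>I. card (E i))" using card_UN_le[OF I(1)] of_nat_mono by blast
  also have "\<dots> = (\<Sum>i\<in>I. real (card (E i)))" by simp
  also have "\<dots> \<le> (\<Sum>i\<in>I. P n * (M * C * r i powr t))"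
  proof (rule sum_mono)
    fix i assume i: "i \<in> I"
    have "real (card (E i)) * P (k i) = real (card (W i)) * P n"
      unfolding E_def P_def by (rule card_extensions[OF \<omega> _ n[OF i]]) (auto simp: W_def)
    also have "real (card (W i)) * P n \<le> M * P n"
    proof (rule mult_right_mono)
      show "real (card (W i)) \<le> M"
        unfolding W_def by (rule M_bound[OF rpos k(1) k(2)]) (rule V_dist)
    qed (use P[of n] in simp)
    also have "\<dots> \<le> M * P n * (C * (P (k i) * scale \<omega> (k i) powr t))"
      using growth[of "k i"] M P[of n] mult_left_mono[of 1 _ "M * P n"] by (simp add: P_def)
    also have "\<dots> \<le> M * P n * (C * (P (k i) * r i powr t))"
      using k(1)[of i] M P C scale_pos[of \<omega> "k i", OF \<omega>] t
      by (intro mult_left_mono powr_mono2) (auto simp: less_imp_le)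
    finally have "real (card (E i)) * P (k i) \<le> (P n * (M * C * r i powr t)) * P (k i)" by (simp add: mult_ac)
    then show "real (card (E i)) \<le> P n * (M * C * r i powr t)"
      by (rule mult_right_le_imp_le) (rule P)
  qed
  also have "\<dots> = P n * (M * C * (\<Sum>i\<in>I. r i powr t))" by (simp add: sum_distrib_left)
  finally have 1: "1 \<le> M * C * (\<Sum>i\<in>I. r i powr t)" using P[of n] by simp
  have "ennreal (\<Sum>i\<in>I. diameter (S i) powr t) = (\<Sum>i\<in>I. ennreal (diameter (S i) powr t))"
    by (intro sum_ennreal[symmetric]) simp
  also have "\<dots> \<le> (\<Sum>i. ennreal (diameter (S i) powr t))"
    by (intro sum_le_suminf) (auto simp: I(1))
  also have "\<dots> < ennreal e" by (rule S(4))
  finally have 2: "(\<Sum>i\<in>I. diameter (S i) powr t) < e"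
    by (simp add: ennreal_less_iff sum_nonneg)
  have "(\<Sum>i\<in>I. e * (1/2) ^ Suc i) \<le> (\<Sum>i. e * (1/2) ^ Suc i)"
    using e by (intro sum_le_suminf I(1) summable_mult) (auto simp: summable_Suc_iff)
  also have "\<dots> = e" using suminf_mult[of "\<lambda>i. (1/2::real) ^ Suc i" e] power_half_series
    by (simp add: sums_iff)
  finally have 3: "(\<Sum>i\<in>I. e * (1/2) ^ Suc i) \<le> e" .
  have "(\<Sum>i\<in>I. r i powr t) \<le> (\<Sum>i\<in>I. diameter (S i) powr t + e * (1/2) ^ Suc i)"
    by (intro sum_mono r(3))
  also have "\<dots> < 2 * e" unfolding sum.distrib using 2 3 by simp
  finally have "M * C * (\<Sum>i\<in>I. r i powr t) < M * C * (2 * e)" using M C by simp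
  also have "\<dots> = 1/2" using M C by (simp add: e_def)
  finally show False using 1 by simp
qed

text \<open>The cylinders of a single level form a cover and their diameters tend to 0, so for every
  mesh it is enough that the cost is small at infinitely many levels.\<close>

lemma hausdorff_measure_attractor_eq_0:
  assumes \<omega>: "\<And>i. \<omega> i \<in> \<Lambda>" and D: "\<And>x y. x \<in> \<Delta> \<Longrightarrow> y \<in> \<Delta> \<Longrightarrow> dist x y \<le> D"
    and h0: "h 0 = 0" and h_mono: "\<And>x y. 0 \<le> x \<Longrightarrow> x \<le> y \<Longrightarrow> h x \<le> h y"
    and small: "\<And>e. 0 < e \<Longrightarrow> \<exists>\<^sub>F k in sequentially. real (card (words \<omega> k)) * h (D * scale \<omega> k) \<le> e"
  shows "hausdorff_measure h (attractor N f \<Delta> \<omega>) = 0"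
proof (rule hausdorff_measure_eq_0I)
  fix \<delta> e :: real assume "0 < \<delta>" "0 < e"
  have "(\<lambda>k. D * scale \<omega> k) \<longlonglongrightarrow> D * 0" by (intro tendsto_intros scale_tendsto_0 \<omega>)
  then have "\<forall>\<^sub>F k in sequentially. D * scale \<omega> k < \<delta>" using \<open>0 < \<delta>\<close> by (intro order_tendstoD) auto
  then have "\<exists>\<^sub>F k in sequentially. D * scale \<omega> k < \<delta> \<and> real (card (words \<omega> k)) * h (D * scale \<omega> k) \<le> e"
    by (intro frequently_rev_mp[OF small[OF \<open>0 < e\<close>]]) (auto elim: eventually_mono)
  then obtain k where k: "D * scale \<omega> k < \<delta>" "real (card (words \<omega> k)) * h (D * scale \<omega> k) \<le> e"
    by (auto dest: frequently_ex)
  obtain \<phi> where \<phi>: "bij_betw \<phi> {..<card (words \<omega> k)} (words \<omega> k)"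
    using ex_bij_betw_nat_finite[OF finite_words[of \<omega> k, OF \<omega>]] unfolding lessThan_atLeast0 by blast
  \<comment> \<open>The finite cover is padded with empty sets, which cost nothing by
    \<open>h0\<close>.\<close>
  define U where "U i = (if i < card (words \<omega> k) then cyl_map f \<omega> (\<phi> i) k ` \<Delta> else {})" for i
  have "attractor N f \<Delta> \<omega> \<subseteq> (\<Union>w\<in>words \<omega> k. cyl_map f \<omega> w k ` \<Delta>)" by (rule attractor_subset[OF \<omega>])
  also have "\<dots> = (\<Union>i. U i)" using \<phi> by (force simp: U_def bij_betw_def)
  finally have cover: "attractor N f \<Delta> \<omega> \<subseteq> (\<Union>i. U i)" .
  have D0: "0 \<le> D" using D Delta(2) zero_le_dist order_trans by blast
  have dist: "dist x y \<le> D * scale \<omega> k" if xU: "x \<in> U i" and yU: "y \<in> U i" for i x y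
  proof -
    obtain p q where pq: "p \<in> \<Delta>" "q \<in> \<Delta>" "x = cyl_map f \<omega> (\<phi> i) k p" "y = cyl_map f \<omega> (\<phi> i) k q" "i < card (words \<omega> k)"
      using xU yU by (auto simp: U_def split: if_splits)
    have "\<phi> i \<in> words \<omega> k" using \<phi> pq(5) by (auto simp: bij_betw_def)
    then have "dist x y = scale \<omega> k * dist p q"
      unfolding pq by (intro dist_cyl_map \<omega> wordsD)
    also have "\<dots> \<le> scale \<omega> k * D" using D pq scale_pos[of \<omega> k, OF \<omega>] by simp
    finally show ?thesis by (simp add: mult.commute)
  qed
  have bdd: "bounded (U i)" for i
    unfolding bounded_two_points using dist by blast
  have diam: "diameter (U i) \<le> D * scale \<omega> k" for i
    using dist D0 scale_pos[of \<omega> k, OF \<omega>] by (intro diameter_le) (auto simp: dist_norm)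
  have "diameter (U i) \<le> \<delta>" for i using diam[of i] k(1) by linarith
  then have "hausdorff_premeasure h (attractor N f \<Delta> \<omega>) \<delta> \<le> (\<Sum>i. ennreal (h (diameter (U i))))"
    unfolding hausdorff_premeasure_def
    using cover bdd by (intro Inf_lower CollectI exI[of _ U]) auto
  also have "\<dots> = (\<Sum>i<card (words \<omega> k). ennreal (h (diameter (U i))))"
    by (intro suminf_finite) (auto simp: U_def h0)
  also have "\<dots> \<le> (\<Sum>i<card (words \<omega> k). ennreal (h (D * scale \<omega> k)))"
    using diam h_mono diameter_ge_0[OF bdd] by (intro sum_mono ennreal_leI) auto
  also have "\<dots> = ennreal (real (card (words \<omega> k)) * h (D * scale \<omega> k))"
    using h_mono[of 0 "D * scale \<omega> k"] h0 D0 scale_pos[of \<omega> k, OF \<omega>]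
    by (simp add: ennreal_mult ennreal_of_nat_eq_real_of_nat)
  also have "\<dots> \<le> ennreal e" using k(2) by (rule ennreal_leI)
  finally show "hausdorff_premeasure h (attractor N f \<Delta> \<omega>) \<delta> \<le> ennreal e" .
qed

end

section \<open>The gauge function\<close>

text \<open>In the variable y = \<beta> ln (1 / t) the triple logarithm becomes ln (ln y), so
  questions about the gauge become questions about sqrt (2 y ln (ln y)) against a linear
  function.\<close>

lemma h1_eq_exp:
  assumes "0 < t"
  shows "h1 s t \<beta> \<gamma> = exp (- s * ln (1 / t) +
    (1 - \<gamma>) * sqrt (2 * (\<beta> * ln (1 / t)) * ln (ln (\<beta> * ln (1 / t)))))"
proof -
  have "ln (1 / t powr \<beta>) = \<beta> * ln (1 / t)"
    using assms by (simp add: ln_div ln_powr)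
  then show ?thesis
    using assms by (simp add: h1_def powr_def ln_div exp_add[symmetric] mult_ac)
qed

text \<open>The derivative of the square root tends to 0, so the linear term eventually dominates,
  whatever the sign of \<open>a\<close>; \<open>D\<close> is the derivative of the whole
  expression.\<close>

lemma ln_ln_sqrt_slope:
  fixes a b :: real
  assumes "0 < b"
  obtains x0 where "\<And>x y. x0 \<le> x \<Longrightarrow> x \<le> y \<Longrightarrow>
    a * sqrt (2 * y * ln (ln y)) - b * y \<le> a * sqrt (2 * x * ln (ln x)) - b * x"
proof -
  define D where "D x = a * ((2 * ln (ln x) + 2 / ln x) / (2 * sqrt (2 * x * ln (ln x)))) - b" for x
  have "((\<lambda>x::real. (2 * ln (ln x) + 2 / ln x) / (2 * sqrt (2 * x * ln (ln x)))) \<longlongrightarrow> 0) at_top"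
    by real_asymp
  then have "((\<lambda>x. D x) \<longlongrightarrow> a * 0 - b) at_top"
    unfolding D_def by (intro tendsto_intros)
  then have "\<forall>\<^sub>F x in at_top. D x < 0" using assms by (intro order_tendstoD) auto
  moreover have "\<forall>\<^sub>F x::real in at_top. 1 < x \<and> 1 < ln x" by (intro eventually_conj) real_asymp+
  ultimately have "\<forall>\<^sub>F x in at_top. D x < 0 \<and> 1 < x \<and> 1 < ln x" by eventually_elim auto
  then obtain x0 where x0: "\<And>x. x0 \<le> x \<Longrightarrow> D x < 0 \<and> 1 < x \<and> 1 < ln x"
    by (auto simp: eventually_at_top_linorder)
  show ?thesis
  proof (rule that)
    fix x y assume xy: "x0 \<le> x" "x \<le> y"
    show "a * sqrt (2 * y * ln (ln y)) - b * y \<le> a * sqrt (2 * x * ln (ln x)) - b * x"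
    proof (rule DERIV_nonpos_imp_nonincreasing[OF xy(2)])
      fix z assume z: "x \<le> z" "z \<le> y"
      then have "D z < 0" "1 < z" "1 < ln z" using x0[of z] xy by auto
      moreover have "0 < z * ln (ln z)" using \<open>1 < z\<close> \<open>1 < ln z\<close> by (intro mult_pos_pos) simp_all
      then have "((\<lambda>z. a * sqrt (2 * z * ln (ln z)) - b * z) has_real_derivative D z) (at z)"
        unfolding D_def using \<open>1 < z\<close> \<open>1 < ln z\<close>
        by (auto intro!: derivative_eq_intros simp: field_simps mult_less_0_iff)
      ultimately show "\<exists>d. ((\<lambda>z. a * sqrt (2 * z * ln (ln z)) - b * z) has_real_derivative d) (at z) \<and> d \<le> 0"
        by (intro exI[of _ "D z"]) auto
    qed
  qed
qed

lemma h1_admissible_exists: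
  assumes "0 < s" "0 < \<beta>"
  shows "\<exists>r0. h1_admissible s \<beta> \<gamma> r0"
proof -
  obtain x0 where x0: "\<And>x y. x0 \<le> x \<Longrightarrow> x \<le> y \<Longrightarrow>
      (1 - \<gamma>) * sqrt (2 * y * ln (ln y)) - s / \<beta> * y \<le> (1 - \<gamma>) * sqrt (2 * x * ln (ln x)) - s / \<beta> * x"
    using ln_ln_sqrt_slope[of "s / \<beta>" "1 - \<gamma>"] assms by auto
  \<comment> \<open>For t up to \<open>exp (- L0)\<close> the quantity \<beta> ln (1 / t) is at
    least \<open>x0\<close>, which gives monotonicity, and at least \<open>exp 1\<close>, which
    makes the nested logarithms defined and the radicand non-negative.\<close>
  define L0 where "L0 = max x0 (exp 1) / \<beta>"
  define r0 where "r0 = exp (- L0)"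
  have L: "max x0 (exp 1) \<le> \<beta> * ln (1 / t)" if "t \<in> {0<..r0}" for t
  proof -
    have "ln t \<le> - L0" using that ln_mono[of t r0] by (simp add: r0_def)
    then have "L0 \<le> ln (1 / t)" using that by (simp add: ln_div)
    then show ?thesis using assms by (simp add: L0_def field_simps)
  qed
  show ?thesis
  proof (intro exI[of _ r0])
    show "h1_admissible s \<beta> \<gamma> r0"
      unfolding h1_admissible_def
    proof (intro conjI ballI)
      show "0 < r0" by (simp add: r0_def)
    next
      fix t assume t: "t \<in> {0<..r0}"
      define x where "x = \<beta> * ln (1 / t)"
      have x: "exp 1 \<le> x" using L[OF t] by (simp add: x_def)
      then have "ln (exp 1) \<le> ln x" by (intro ln_mono) simp_all
      then have lx: "1 \<le> ln x" by simp
      have "1 < x" using x exp_ge_add_one_self[of "1::real"] by linarith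
      moreover have "ln (1 / t powr \<beta>) = x" using t by (simp add: x_def ln_div ln_powr)
      moreover have "0 \<le> 2 * x * ln (ln x)" using \<open>1 < x\<close> lx by simp
      ultimately show "h1_defined t \<beta>"
        unfolding h1_defined_def using lx t by (simp add: x_def mult.assoc)
    next
      show "mono_on {0<..r0} (\<lambda>t. h1 s t \<beta> \<gamma>)"
      proof (rule mono_onI)
        fix t t' assume t: "t \<in> {0<..r0}" "t' \<in> {0<..r0}" "t \<le> t'"
        have le: "\<beta> * ln (1 / t') \<le> \<beta> * ln (1 / t)"
          using t assms by (intro mult_left_mono ln_mono) (auto simp: field_simps)
        have eq: "s / \<beta> * (\<beta> * y) = s * y" for y using assms by simp
        show "h1 s t \<beta> \<gamma> \<le> h1 s t' \<beta> \<gamma>"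
          using x0[OF _ le] L[OF t(2)] t unfolding eq by (simp add: h1_eq_exp)
      qed
    qed
  qed
qed

lemma h1_gauge_mono:
  assumes "h1_admissible s \<beta> \<gamma> r0" "0 \<le> x" "x \<le> y"
  shows "h1_gauge s \<beta> \<gamma> r0 x \<le> h1_gauge s \<beta> \<gamma> r0 y"
proof -
  have r0: "0 < r0" and m: "\<And>x y. 0 < x \<Longrightarrow> x \<le> y \<Longrightarrow> y \<le> r0 \<Longrightarrow> h1 s x \<beta> \<gamma> \<le> h1 s y \<beta> \<gamma>"
    using assms(1) by (auto simp: h1_admissible_def mono_on_def)
  have "0 \<le> h1 s t \<beta> \<gamma>" for t by (simp add: h1_def)
  then show ?thesis
    using assms(2,3) r0 m[of x y] m[of x r0] by (auto simp: h1_gauge_def)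
qed

text \<open>The correction grows with \<beta> ln (1 / t), so bounding this by
  \<open>\<theta> * x\<close> leaves a factor \<open>sqrt (2 * \<theta>)\<close> in front of sqrt (x
  ln (ln x)); \<open>\<theta> \<le> 1\<close> controls the iterated logarithm. It will be applied
  with \<open>x\<close> the level of a cylinder.\<close>

lemma h1_gauge_le:
  assumes adm: "h1_admissible s \<beta> \<gamma> r0" and t: "0 < t" "t \<le> r0" and "0 \<le> \<gamma>"
    and L: "\<beta> * ln (1 / t) \<le> \<theta> * x" and "\<theta> \<le> 1" "0 \<le> x"
  shows "h1_gauge s \<beta> \<gamma> r0 t \<le> exp (- s * ln (1 / t) + sqrt (2 * \<theta>) * sqrt (x * ln (ln x)))"
proof -
  define y where "y = \<beta> * ln (1 / t)"
  have eq: "ln (1 / t powr \<beta>) = y" "2 * \<beta> * ln (1 / t) = 2 * y"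
    using t by (simp_all add: y_def ln_div ln_powr)
  have "h1_defined t \<beta>" using adm t by (simp add: h1_admissible_def)
  \<comment> \<open>The signs come from the formula being defined at \<open>t\<close>, which is part
    of admissibility.\<close>
  then have y: "0 < y" "0 < ln y" "0 \<le> 2 * y * ln (ln y)"
    unfolding h1_defined_def eq by auto
  then have y1: "0 \<le> ln (ln y)" by (simp add: zero_le_mult_iff)
  have yx: "y \<le> \<theta> * x" using L by (simp add: y_def)
  also have "\<theta> * x \<le> 1 * x" using assms by (intro mult_right_mono) auto
  finally have "y \<le> x" by simp
  then have lnln: "ln (ln y) \<le> ln (ln x)" using y by (intro ln_mono) auto
  have "(1 - \<gamma>) * sqrt (2 * y * ln (ln y)) \<le> 1 * sqrt (2 * y * ln (ln y))"
    using \<open>0 \<le> \<gamma>\<close> y by (intro mult_right_mono) auto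
  also have "\<dots> \<le> 1 * sqrt (2 * (\<theta> * x) * ln (ln x))"
    using yx y y1 lnln by (intro mult_left_mono real_sqrt_le_mono mult_mono) auto
  also have "\<dots> = sqrt (2 * \<theta>) * sqrt (x * ln (ln x))"
    by (simp add: real_sqrt_mult[symmetric] mult_ac)
  finally show ?thesis
    using t by (simp add: h1_gauge_def h1_eq_exp y_def)
qed

text \<open>Covers of mesh at most 1 suffice, and for such diameters the power decreases as the
  exponent grows.\<close>

lemma hausdorff_measure_powr_eq_0_mono:
  assumes "hausdorff_measure (\<lambda>x. x powr v) F = 0" "v \<le> u"
  shows "hausdorff_measure (\<lambda>x. x powr u) F = 0"
proof (rule hausdorff_measure_eq_0I)
  fix \<delta> e :: real assume "0 < \<delta>" "0 < e"
  obtain U where U: "F \<subseteq> (\<Union>i. U i)" "\<And>i. bounded (U i)" "\<And>i. diameter (U i) \<le> min \<delta> 1"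
      "(\<Sum>i. ennreal (diameter (U i) powr v)) < ennreal e"
    by (rule small_cover_of_hausdorff_measure_eq_0[OF assms(1), of "min \<delta> 1" e]) (use \<open>0 < \<delta>\<close> \<open>0 < e\<close> in auto)
  have "hausdorff_premeasure (\<lambda>x. x powr u) F \<delta> \<le> (\<Sum>i. ennreal (diameter (U i) powr u))"
    unfolding hausdorff_premeasure_def using U(1-3) by (intro Inf_lower) auto
  also have "\<dots> \<le> (\<Sum>i. ennreal (diameter (U i) powr v))"
    using U(2,3) assms(2) by (intro suminf_le ennreal_leI powr_mono' diameter_ge_0) auto
  also have "\<dots> \<le> ennreal e" using U(4) by simp
  finally show "hausdorff_premeasure (\<lambda>x. x powr u) F \<delta> \<le> ennreal e" .
qed

text \<open>The reciprocals of the finitely many exceptional terms are absorbed into the constant.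
  This supplies the uniform growth bound for the mass distribution argument.\<close>

lemma uniform_bound_of_eventually:
  fixes a :: "nat \<Rightarrow> real"
  assumes "\<And>k. 0 < a k" "\<forall>\<^sub>F k in sequentially. 1 \<le> a k"
  obtains C where "0 < C" "\<And>k. 1 \<le> C * a k"
proof -
  obtain n where n: "\<And>k. n \<le> k \<Longrightarrow> 1 \<le> a k" using assms(2) by (auto simp: eventually_sequentially)
  define C where "C = 1 + (\<Sum>k<n. 1 / a k)"
  have C1: "1 \<le> C" using assms(1) by (simp add: C_def sum_nonneg less_imp_le)
  show ?thesis
  proof (rule that[of C])
    show "1 \<le> C * a k" for k
    proof (cases "k < n")
      case True
      then have "1 / a k \<le> (\<Sum>k<n. 1 / a k)" using assms(1) by (intro member_le_sum) (auto simp: less_imp_le)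
      then have "1 / a k * a k \<le> C * a k" using assms(1)[of k] by (intro mult_right_mono) (auto simp: C_def)
      then show ?thesis using assms(1)[of k] by simp
    next
      case False
      then show ?thesis using n[of k] C1 mult_mono[of 1 C 1 "a k"] by simp
    qed
  qed (use C1 in simp)
qed

section \<open>Dimension and gauge measure of the random attractor\<close>

locale bounded_homogeneous_rifs = homogeneous_rifs \<mu> \<Lambda> N f c \<Delta> cmin cmax
  for \<mu> :: "(real ^ 'k) measure" and \<Lambda> N and f :: "real ^ 'k \<Rightarrow> nat \<Rightarrow> real ^ 'd \<Rightarrow> real ^ 'd" and c \<Delta> cmin cmax +
  assumes bdd_N: "bdd_above (N ` \<Lambda>)"
begin

text \<open>For equal ratios this is the logarithm of \<open>ratio_sum N c l u\<close>, written so
  that it is affine in \<open>u\<close>; it is the step of the random walk.\<close>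

definition log_sum :: "real \<Rightarrow> real ^ 'k \<Rightarrow> real" where
  "log_sum u l = ln (real (N l)) + u * ln (c l 1)"

text \<open>The ratio is the distance between the images of 0 and of a unit vector under the first
  map. Index 1 is available for every parameter, so the measurability assumption on this map
  concerns the whole space.\<close>

lemma ratio_measurable: "(\<lambda>l. c l 1) \<in> borel_measurable \<mu>"
proof -
  define v :: "real ^ 'd" where "v = axis undefined 1"
  have v: "norm v = 1" by (simp add: v_def)
  have "{l \<in> \<Lambda>. 1 \<le> N l} = space \<mu>" using N_ge_1 space_mu by auto
  moreover have "sets (restrict_space \<mu> (space \<mu>)) = (\<lambda>A. A) ` sets \<mu>"
    unfolding sets_restrict_space by (rule image_cong) (simp_all add: sets.Int_space_eq1)
  then have "borel_measurable (restrict_space \<mu> (space \<mu>)) = (borel_measurable \<mu> :: (real ^ 'k \<Rightarrow> real ^ 'd) set)"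
    by (intro measurable_cong_sets) simp_all
  ultimately have *: "(\<lambda>l. f l 1 x) \<in> borel_measurable \<mu>" for x
    using f_measurable[of 1 x] by simp
  have "(\<lambda>l. norm (f l 1 v - f l 1 0)) \<in> borel_measurable \<mu>"
    using *[of v] *[of 0] by measurable
  moreover have "norm (f l 1 v - f l 1 0) = c l 1" if "l \<in> space \<mu>" for l
    using similarity[of l 1 v 0] that N_ge_1[of l] v by (simp add: space_mu)
  ultimately show ?thesis by (simp cong: measurable_cong)
qed

lemma ln_ratio_bounds:
  assumes "l \<in> \<Lambda>"
  shows "ln cmin \<le> ln (c l 1)" "ln (c l 1) \<le> ln cmax" "0 < c l 1" "ln cmax < 0"
proof -
  have "cmin \<le> c l 1" "c l 1 \<le> cmax" using c_bounds[OF assms] by auto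
  then show "ln cmin \<le> ln (c l 1)" "ln (c l 1) \<le> ln cmax" "0 < c l 1" "ln cmax < 0"
    using cmin_pos cmax_less_1 by auto
qed

lemma log_sum_bounded_iid: "\<exists>B. bounded_iid \<mu> (log_sum u) B"
proof -
  obtain n where n: "\<And>l. l \<in> \<Lambda> \<Longrightarrow> N l \<le> n" using bdd_N by (auto simp: bdd_above_def)
  \<comment> \<open>The final \<open>+ 1\<close> makes the bound strictly positive, as the locale
    demands.\<close>
  have "bounded_iid \<mu> (log_sum u) (ln (real n + 1) + \<bar>u\<bar> * (- ln cmin) + 1)"
  proof unfold_locales
    show "log_sum u \<in> borel_measurable \<mu>"
      using ratio_measurable N_measurable unfolding log_sum_def[abs_def] by measurable
    obtain l0 where l0: "l0 \<in> \<Lambda>" using Lambda(2) by blast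
    have "ln cmin \<le> 0" using ln_ratio_bounds[OF l0] by simp
    then show "0 < ln (real n + 1) + \<bar>u\<bar> * (- ln cmin) + 1"
      by (intro add_nonneg_pos add_nonneg_nonneg mult_nonneg_nonneg) auto
    fix l assume "l \<in> space \<mu>"
    then have l: "l \<in> \<Lambda>" by (simp add: space_mu)
    have "\<bar>ln (real (N l))\<bar> \<le> ln (real n + 1)" using n[OF l] N_ge_1[OF l] by simp
    moreover have "\<bar>u * ln (c l 1)\<bar> \<le> \<bar>u\<bar> * (- ln cmin)"
      unfolding abs_mult using ln_ratio_bounds[OF l] by (intro mult_left_mono) auto
    ultimately show "\<bar>log_sum u l\<bar> \<le> ln (real n + 1) + \<bar>u\<bar> * (- ln cmin) + 1"
      unfolding log_sum_def by linarith
  qed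
  then show ?thesis by blast
qed

lemma integrable_log_sum: "integrable \<mu> (log_sum u)"
  using log_sum_bounded_iid bounded_iid.integrable_g by blast

lemma ln_ratio_sum: "l \<in> \<Lambda> \<Longrightarrow> ln (ratio_sum N c l u) = log_sum u l"
proof -
  assume l: "l \<in> \<Lambda>"
  have "ratio_sum N c l u = (\<Sum>j\<in>{1..N l}. c l 1 powr u)"
    unfolding ratio_sum_def
    by (intro sum.cong refl arg_cong[where f="\<lambda>x. x powr u"] homogeneous[OF l])
  then have "ratio_sum N c l u = real (N l) * c l 1 powr u" by simp
  then show ?thesis using N_ge_1[OF l] ln_ratio_bounds[OF l] by (simp add: log_sum_def ln_mult ln_powr)
qed

lemma ratio_sum_pos: "l \<in> \<Lambda> \<Longrightarrow> 0 < ratio_sum N c l u"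
  unfolding ratio_sum_def using ratio[of l] N_ge_1[of l] by (intro sum_pos) fastforce+

text \<open>The mean step of the walk. It is affine and strictly decreasing in \<open>u\<close>, and
  its zero will be identified with the dimension.\<close>

definition pressure :: "real \<Rightarrow> real" where
  "pressure u = expectation (log_sum u)"

lemma expectation_ln_ratio_neg: "expectation (\<lambda>l. ln (c l 1)) < 0"
proof -
  obtain l0 where l0: "l0 \<in> \<Lambda>" using Lambda(2) by blast
  have "integrable \<mu> (\<lambda>l. log_sum 1 l - log_sum 0 l)" by (intro Bochner_Integration.integrable_diff integrable_log_sum)
  then have i: "integrable \<mu> (\<lambda>l. ln (c l 1))" by (simp add: log_sum_def)
  have "expectation (\<lambda>l. ln (c l 1)) \<le> expectation (\<lambda>l. ln cmax)"
    by (intro integral_mono i) (use ln_ratio_bounds(2) in \<open>simp_all add: space_mu\<close>)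
  also have "\<dots> = ln cmax" by (simp add: prob_space)
  also have "\<dots> < 0" using ln_ratio_bounds[OF l0] by simp
  finally show ?thesis .
qed

lemma pressure_eq: "pressure u = pressure 0 + u * expectation (\<lambda>l. ln (c l 1))"
proof -
  have "integrable \<mu> (\<lambda>l. log_sum 1 l - log_sum 0 l)" by (intro Bochner_Integration.integrable_diff integrable_log_sum)
  then have i: "integrable \<mu> (\<lambda>l. ln (c l 1))" by (simp add: log_sum_def)
  have "log_sum u = (\<lambda>l. log_sum 0 l + u * ln (c l 1))" by (simp add: log_sum_def fun_eq_iff)
  then show ?thesis
    unfolding pressure_def using Bochner_Integration.integral_add[OF integrable_log_sum[of 0] integrable_mult_right[OF i, of u]]
    by simp
qed

lemma PH_in_Lambda: "\<omega> \<in> space (PH \<mu>) \<Longrightarrow> \<omega> i \<in> \<Lambda>"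
  by (auto simp: PH_def space_PiM space_mu)

text \<open>Translates the cost of covering by the cylinders of one level into the exponential of
  the random walk.\<close>

lemma card_words_times_scale:
  assumes \<omega>: "\<And>i. \<omega> i \<in> \<Lambda>"
  shows "real (card (words \<omega> k)) * scale \<omega> k powr u = exp (\<Sum>i<k. log_sum u (\<omega> i))"
proof -
  have "exp (log_sum u (\<omega> i)) = real (N (\<omega> i)) * c (\<omega> i) 1 powr u" for i
    using ln_ratio_bounds(3)[OF \<omega>[of i]] N_ge_1[OF \<omega>[of i]] by (simp add: log_sum_def exp_add powr_def)
  then have "exp (\<Sum>i<k. log_sum u (\<omega> i)) = (\<Prod>i<k. real (N (\<omega> i)) * c (\<omega> i) 1 powr u)"
    by (simp add: exp_sum)
  also have "\<dots> = (\<Prod>i<k. real (N (\<omega> i))) * (\<Prod>i<k. c (\<omega> i) 1 powr u)" by (rule prod.distrib)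
  also have "(\<Prod>i<k. c (\<omega> i) 1 powr u) = scale \<omega> k powr u"
    unfolding scale_def by (rule prod_powr_distrib[symmetric])
  also have "(\<Prod>i<k. real (N (\<omega> i))) = real (card (words \<omega> k))"
    unfolding card_words[OF \<omega>] by simp
  finally show ?thesis by simp
qed

lemma Delta_dist_bound: obtains D where "1 \<le> D" "\<And>x y. x \<in> \<Delta> \<Longrightarrow> y \<in> \<Delta> \<Longrightarrow> dist x y \<le> D"
proof -
  obtain e where "\<And>x y. x \<in> \<Delta> \<Longrightarrow> y \<in> \<Delta> \<Longrightarrow> dist x y \<le> e"
    using compact_imp_bounded[OF Delta(1)] unfolding bounded_two_points by blast
  then show ?thesis by (intro that[of "max 1 e"]) (auto simp: le_max_iff_disj)
qed

section \<open>Almost sure dimension\<close>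

lemma AE_log_sum_asymptotics:
  assumes "0 < e"
  shows "AE \<omega> in PH \<mu>. \<forall>\<^sub>F n in sequentially. \<bar>(\<Sum>i<n. log_sum u (\<omega> i)) - real n * pressure u\<bar> < e * real n"
  using log_sum_bounded_iid[of u] bounded_iid.strong_law[of \<mu> "log_sum u" _ e] assms unfolding pressure_def by blast

lemma AE_hausdorff_measure_pos:
  assumes "UOSC \<Lambda> N f" "0 < u" "0 < pressure u"
  shows "AE \<omega> in PH \<mu>. hausdorff_measure (\<lambda>x. x powr u) (attractor N f \<Delta> \<omega>) \<noteq> 0"
  \<comment> \<open>A deviation of less than \<open>pressure u\<close> per step keeps the walk
    eventually positive.\<close>
  using AE_log_sum_asymptotics[OF assms(3), of u] AE_space
proof eventually_elim
  case (elim \<omega>)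
  have \<omega>: "\<omega> i \<in> \<Lambda>" for i using elim(2) by (rule PH_in_Lambda)
  have "\<forall>\<^sub>F k in sequentially. 1 \<le> real (card (words \<omega> k)) * scale \<omega> k powr u"
    using elim(1) by eventually_elim (simp add: card_words_times_scale \<omega> abs_less_iff algebra_simps)
  moreover have "0 < real (card (words \<omega> k)) * scale \<omega> k powr u" for k
    by (simp add: card_words_times_scale \<omega>)
  ultimately obtain C where "0 < C" "\<And>k. 1 \<le> C * (real (card (words \<omega> k)) * scale \<omega> k powr u)"
    using uniform_bound_of_eventually[of "\<lambda>k. real (card (words \<omega> k)) * scale \<omega> k powr u"] by blast
  then show ?case by (intro hausdorff_measure_attractor_pos[OF assms(1) \<omega> assms(2)])
qed

lemma AE_hausdorff_measure_zero:
  assumes "0 < u" "pressure u < 0"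
  shows "AE \<omega> in PH \<mu>. hausdorff_measure (\<lambda>x. x powr u) (attractor N f \<Delta> \<omega>) = 0"
proof -
  \<comment> \<open>A deviation of half the mean still leaves decay by the factor exp (pressure u /
    2) per level.\<close>
  have "0 < - pressure u / 2" using assms by simp
  from AE_log_sum_asymptotics[OF this, of u] AE_space show ?thesis
  proof eventually_elim
    case (elim \<omega>)
    have \<omega>: "\<omega> i \<in> \<Lambda>" for i using elim(2) by (rule PH_in_Lambda)
    obtain D where D: "1 \<le> D" "\<And>x y. x \<in> \<Delta> \<Longrightarrow> y \<in> \<Delta> \<Longrightarrow> dist x y \<le> D" by (rule Delta_dist_bound) blast
    define q where "q = exp (pressure u / 2)"
    have q: "0 < q" "q < 1" using assms by (auto simp: q_def)
    have "(\<lambda>k. D powr u * q ^ k) \<longlonglongrightarrow> D powr u * 0"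
      using q by (intro tendsto_intros LIMSEQ_realpow_zero) auto
    then have lim: "(\<lambda>k. D powr u * q ^ k) \<longlonglongrightarrow> 0" by simp
    have le: "\<forall>\<^sub>F k in sequentially. real (card (words \<omega> k)) * (D * scale \<omega> k) powr u \<le> D powr u * q ^ k"
      using elim(1)
    proof eventually_elim
      case (elim k)
      have "real (card (words \<omega> k)) * (D * scale \<omega> k) powr u = D powr u * exp (\<Sum>i<k. log_sum u (\<omega> i))"
        using D(1) scale_pos[of \<omega> k, OF \<omega>]
        by (simp add: powr_mult card_words_times_scale[symmetric] \<omega>)
      also have "\<dots> \<le> D powr u * q ^ k"
      proof (rule mult_left_mono)
        have "(\<Sum>i<k. log_sum u (\<omega> i)) \<le> real k * (pressure u / 2)"
          using elim by (simp add: abs_less_iff algebra_simps)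
        then show "exp (\<Sum>i<k. log_sum u (\<omega> i)) \<le> q ^ k"
          unfolding q_def exp_of_nat_mult[symmetric] by simp
      qed simp
      finally show ?case .
    qed
    show ?case
    proof (rule hausdorff_measure_attractor_eq_0[OF \<omega> D(2)])
      fix e :: real assume "0 < e"
      then have "\<forall>\<^sub>F k in sequentially. D powr u * q ^ k < e" using lim by (intro order_tendstoD)
      with le have "\<forall>\<^sub>F k in sequentially. real (card (words \<omega> k)) * (D * scale \<omega> k) powr u \<le> e"
        by eventually_elim simp
      then show "\<exists>\<^sub>F k in sequentially. real (card (words \<omega> k)) * (D * scale \<omega> k) powr u \<le> e"
        by (rule eventually_frequently[rotated]) simp
    qed (use assms in \<open>auto intro: powr_mono2\<close>)
  qed
qed

text \<open>The pressure vanishes at \<open>z\<close>; positive exponents below \<open>z\<close>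
  almost surely have non-zero measure, those above have measure zero. If \<open>s\<close> differed
  from \<open>z\<close>, one exponent strictly between them would contradict the value
  \<open>s\<close> almost surely, which is impossible on a probability space.\<close>

lemma dimension_zero_of_pressure:
  assumes U: "UOSC \<Lambda> N f" and p0: "0 < pressure 0"
    and dim: "AE \<omega> in PH \<mu>. hausdorff_dim (attractor N f \<Delta> \<omega>) = s"
  shows "0 < s" "pressure s = 0"
proof -
  interpret PH: prob_space "PH \<mu>" unfolding PH_def by (intro prob_space_PiM prob_space_axioms)
  define a where "a = - expectation (\<lambda>l. ln (c l 1))"
  have a: "0 < a" using expectation_ln_ratio_neg by (simp add: a_def)
  have p: "pressure u = pressure 0 - u * a" for u using pressure_eq[of u] by (simp add: a_def)
  define z where "z = pressure 0 / a"
  have z: "0 < z" using a p0 by (simp add: z_def)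
  have p_neg: "pressure u < 0" if "z < u" for u
    using that a unfolding p[of u] z_def by (simp add: field_simps)
  have p_pos: "0 < pressure u" if "u < z" for u
    using that a unfolding p[of u] z_def by (simp add: field_simps)
  have "s = z"
  proof (rule ccontr)
    assume "s \<noteq> z"
    then consider "s < z" | "z < s" by linarith
    then show False
    proof cases
      case 1
      obtain u where u: "max s 0 < u" "u < z" using dense[of "max s 0" z] 1 z by auto
      have "AE \<omega> in PH \<mu>. hausdorff_measure (\<lambda>x. x powr u) (attractor N f \<Delta> \<omega>) \<noteq> 0"
        using u p_pos by (intro AE_hausdorff_measure_pos U) auto
      \<comment> \<open>An exponent of measure zero guarantees that the real infimum defining the
        dimension is taken over a non-empty set.\<close>
      moreover have "AE \<omega> in PH \<mu>. hausdorff_measure (\<lambda>x. x powr (z + 1)) (attractor N f \<Delta> \<omega>) = 0"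
        using z p_neg by (intro AE_hausdorff_measure_zero) auto
      ultimately have "AE \<omega> in PH \<mu>. False"
        using dim
      proof eventually_elim
        case (elim \<omega>)
        have "u \<le> hausdorff_dim (attractor N f \<Delta> \<omega>)"
          unfolding hausdorff_dim_def
        proof (rule cInf_greatest)
          show "{s. 0 \<le> s \<and> hausdorff_measure (\<lambda>t. t powr s) (attractor N f \<Delta> \<omega>) = 0} \<noteq> {}"
            using elim(2) z by (auto intro!: exI[of _ "z + 1"])
          fix v assume v: "v \<in> {s. 0 \<le> s \<and> hausdorff_measure (\<lambda>t. t powr s) (attractor N f \<Delta> \<omega>) = 0}"
          show "u \<le> v"
          proof (rule ccontr)
            assume "\<not> u \<le> v"
            then have "hausdorff_measure (\<lambda>t. t powr u) (attractor N f \<Delta> \<omega>) = 0"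
              using v by (auto intro: hausdorff_measure_powr_eq_0_mono[of v _ u])
            with elim(1) show False ..
          qed
        qed
        with elim(3) u show False by simp
      qed
      then show False by simp
    next
      case 2
      obtain u where u: "z < u" "u < s" using dense[OF 2] by blast
      have "AE \<omega> in PH \<mu>. hausdorff_measure (\<lambda>x. x powr u) (attractor N f \<Delta> \<omega>) = 0"
        using u z p_neg by (intro AE_hausdorff_measure_zero) auto
      then have "AE \<omega> in PH \<mu>. False"
        using dim
      proof eventually_elim
        case (elim \<omega>)
        have "hausdorff_dim (attractor N f \<Delta> \<omega>) \<le> u"
          unfolding hausdorff_dim_def using elim(1) u z by (intro cInf_lower bdd_belowI[of _ 0]) auto
        with elim(2) u show False by simp
      qed
      then show False by simp
    qed
  qed
  then show "0 < s" "pressure s = 0" using z a by (simp_all add: p[of z]) (simp add: p[of s] z_def)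
qed

text \<open>A centred step of variance zero vanishes almost everywhere; then almost all ratio sums
  at \<open>s\<close> equal 1, which is almost determinism.\<close>

lemma variance_log_sum_pos:
  assumes "\<not> almost_deterministic \<mu> N c" "pressure s = 0"
  shows "0 < variance (log_sum s)"
proof (rule ccontr)
  obtain B where "bounded_iid \<mu> (log_sum s) B" using log_sum_bounded_iid by blast
  then interpret L: bounded_iid \<mu> "log_sum s" B .
  assume "\<not> 0 < variance (log_sum s)"
  moreover have "0 \<le> variance (log_sum s)" by simp
  ultimately have "expectation (\<lambda>l. (log_sum s l)\<^sup>2) = 0" using assms(2) by (simp add: pressure_def)
  moreover have "integrable \<mu> (\<lambda>l. (log_sum s l)\<^sup>2)"
  proof (rule integrable_const_bound[of _ "B\<^sup>2"])
    show "AE l in \<mu>. norm ((log_sum s l)\<^sup>2) \<le> B\<^sup>2"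
      using AE_space by eventually_elim (use L.bounded L.B_pos in \<open>auto simp: abs_le_square_iff[symmetric]\<close>)
  qed simp
  ultimately have "AE l in \<mu>. (log_sum s l)\<^sup>2 = 0"
    by (subst (asm) integral_nonneg_eq_0_iff_AE) auto
  then have "AE l in \<mu>. ratio_sum N c l s = 1"
    using AE_space
  proof eventually_elim
    case (elim l)
    then have "ln (ratio_sum N c l s) = 0" "0 < ratio_sum N c l s"
      using ln_ratio_sum ratio_sum_pos by (auto simp: space_mu)
    then show ?case by simp
  qed
  with assms(1) show False unfolding almost_deterministic_def by blast
qed

section \<open>Gauge measure along favourable levels\<close>

lemma ln_inverse_scale_le:
  assumes \<omega>: "\<And>i. \<omega> i \<in> \<Lambda>" and D: "1 \<le> D"
  shows "ln (1 / (D * scale \<omega> k)) \<le> real k * (- ln cmin)"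
proof -
  have "cmin ^ k = (\<Prod>i<k. cmin)" by simp
  also have "\<dots> \<le> scale \<omega> k"
    unfolding scale_def using c_bounds[OF \<omega>] cmin_pos by (intro prod_mono) auto
  also have "\<dots> \<le> D * scale \<omega> k" using D scale_pos[of \<omega> k, OF \<omega>] by simp
  finally have "ln (cmin ^ k) \<le> ln (D * scale \<omega> k)" using cmin_pos by (intro ln_mono) auto
  then show ?thesis
    using D scale_pos[of \<omega> k, OF \<omega>] cmin_pos by (simp add: ln_div ln_realpow)
qed

text \<open>With q = sqrt (k ln (ln k)), the walk is at most - \<delta> q at infinitely many levels
  k, while for small \<beta> the correction in the gauge is at most exp (\<delta> q / 2). The cost
  of covering therefore tends to 0 along these levels.\<close>

lemma AE_gauge_measure_zero:
  assumes s: "0 < s" "pressure s = 0" and var: "0 < variance (log_sum s)" and \<epsilon>: "0 \<le> \<epsilon>"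
  shows "\<exists>\<beta>0>0. \<forall>\<beta> r0. 0 < \<beta> \<longrightarrow> \<beta> \<le> \<beta>0 \<longrightarrow> h1_admissible s \<beta> \<epsilon> r0 \<longrightarrow>
    (AE \<omega> in PH \<mu>. hausdorff_measure (h1_gauge s \<beta> \<epsilon> r0) (attractor N f \<Delta> \<omega>) = 0)"
proof -
  obtain B where "bounded_iid \<mu> (log_sum s) B" using log_sum_bounded_iid by blast
  then interpret L: bounded_iid \<mu> "log_sum s" B .
  obtain \<delta> where \<delta>: "0 < \<delta>" and lil: "AE \<omega> in PH \<mu>. \<exists>\<^sub>F n in sequentially.
       (\<Sum>i<n. log_sum s (\<omega> i)) \<le> - \<delta> * sqrt (real n * ln (ln (real n)))"
    using L.weak_iterated_logarithm s(2) var unfolding pressure_def by blast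
  obtain D where D: "1 \<le> D" "\<And>x y. x \<in> \<Delta> \<Longrightarrow> y \<in> \<Delta> \<Longrightarrow> dist x y \<le> D" by (rule Delta_dist_bound) blast
  define b where "b = - ln cmin"
  have b: "0 < b"
  proof -
    obtain l0 where "l0 \<in> \<Lambda>" using Lambda(2) by blast
    from ln_ratio_bounds[OF this] show ?thesis by (simp add: b_def)
  qed
  \<comment> \<open>\<open>\<delta>\<^sup>2 / 8\<close> makes \<open>sqrt (2 * \<theta>)\<close> at
    most \<open>\<delta> / 2\<close>, and the cap at 1 is required by \<open>h1_gauge_le\<close>.
    Since ln (1 / t) is at most \<open>b\<close> times the level, \<beta> \<le> \<theta> / b is the
    right smallness condition.\<close>
  define \<theta> where "\<theta> = min 1 (\<delta>\<^sup>2 / 8)"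
  have \<theta>: "0 < \<theta>" "\<theta> \<le> 1" using \<delta> by (auto simp: \<theta>_def)
  have "sqrt (2 * \<theta>) \<le> sqrt ((\<delta> / 2)\<^sup>2)" by (intro real_sqrt_le_mono) (simp add: \<theta>_def power_divide)
  then have sq: "sqrt (2 * \<theta>) \<le> \<delta> / 2" using \<delta> by simp
  show ?thesis
  proof (intro exI[of _ "\<theta> / b"] conjI allI impI)
    show "0 < \<theta> / b" using \<theta> b by simp
    fix \<beta> r0 assume \<beta>: "0 < \<beta>" "\<beta> \<le> \<theta> / b" and adm: "h1_admissible s \<beta> \<epsilon> r0"
    have r0: "0 < r0" using adm by (simp add: h1_admissible_def)
    show "AE \<omega> in PH \<mu>. hausdorff_measure (h1_gauge s \<beta> \<epsilon> r0) (attractor N f \<Delta> \<omega>) = 0"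
      using lil AE_space
    proof eventually_elim
      case (elim \<omega>)
      have \<omega>: "\<omega> i \<in> \<Lambda>" for i using elim(2) by (rule PH_in_Lambda)
      define G where "G k = D powr s * exp (- (\<delta> / 2) * sqrt (real k * ln (ln (real k))))" for k
      have G: "G \<longlonglongrightarrow> 0"
      proof -
        have "filterlim (\<lambda>k. sqrt (real k * ln (ln (real k)))) at_top sequentially" by real_asymp
        then have "filterlim (\<lambda>k. (\<delta> / 2) * sqrt (real k * ln (ln (real k)))) at_top sequentially"
          using \<delta> by (intro filterlim_tendsto_pos_mult_at_top[OF tendsto_const]) auto
        then have "((\<lambda>k. exp (- ((\<delta> / 2) * sqrt (real k * ln (ln (real k)))))) \<longlonglongrightarrow> 0)"
          by (intro filterlim_compose[OF exp_at_bot] filterlim_uminus_at_bot[THEN iffD1]) (simp add: filterlim_uminus_at_top)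
        then have "(\<lambda>k. D powr s * exp (- ((\<delta> / 2) * sqrt (real k * ln (ln (real k)))))) \<longlonglongrightarrow> D powr s * 0"
          by (intro tendsto_intros)
        then show ?thesis by (simp add: G_def[abs_def])
      qed
      have "(\<lambda>k. D * scale \<omega> k) \<longlonglongrightarrow> D * 0" by (intro tendsto_intros scale_tendsto_0 \<omega>)
      then have small: "\<forall>\<^sub>F k in sequentially. D * scale \<omega> k < r0" using r0 by (intro order_tendstoD) auto
      have bound: "real (card (words \<omega> k)) * h1_gauge s \<beta> \<epsilon> r0 (D * scale \<omega> k) \<le> G k"
        if k: "D * scale \<omega> k < r0" and S: "(\<Sum>i<k. log_sum s (\<omega> i)) \<le> - \<delta> * sqrt (real k * ln (ln (real k)))"
          and k3: "3 \<le> k" for k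
      proof -
        define t where "t = D * scale \<omega> k"
        define q where "q = sqrt (real k * ln (ln (real k)))"
        have t: "0 < t" "t \<le> r0" using D(1) scale_pos[of \<omega> k, OF \<omega>] k by (auto simp: t_def)
        have "ln (1 / t) \<le> real k * b" using ln_inverse_scale_le[OF \<omega> D(1)] by (simp add: t_def b_def)
        then have "\<beta> * ln (1 / t) \<le> \<beta> * (real k * b)" using \<beta> by (intro mult_left_mono) auto
        also have "\<dots> \<le> \<theta> / b * (real k * b)" using \<beta> b by (intro mult_right_mono) auto
        also have "\<dots> = \<theta> * real k" using b by simp
        finally have "h1_gauge s \<beta> \<epsilon> r0 t \<le> exp (- s * ln (1 / t) + sqrt (2 * \<theta>) * q)"
          unfolding q_def by (intro h1_gauge_le[OF adm t \<epsilon>] \<theta>) auto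
        also have "\<dots> = t powr s * exp (sqrt (2 * \<theta>) * q)"
          using t by (simp add: exp_add powr_def ln_div)
        finally have "real (card (words \<omega> k)) * h1_gauge s \<beta> \<epsilon> r0 t
           \<le> real (card (words \<omega> k)) * (t powr s * exp (sqrt (2 * \<theta>) * q))" by (intro mult_left_mono) auto
        also have "\<dots> = D powr s * (exp (\<Sum>i<k. log_sum s (\<omega> i)) * exp (sqrt (2 * \<theta>) * q))"
          using D(1) scale_pos[of \<omega> k, OF \<omega>]
          by (simp add: t_def powr_mult card_words_times_scale[symmetric] \<omega>)
        also have "\<dots> \<le> D powr s * exp (- (\<delta> / 2) * q)"
        proof -
          \<comment> \<open>Levels from 3 on are at least exp 1, which makes the iterated logarithm
            non-negative.\<close>
          have "0 \<le> ln (ln (real k))"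
          proof -
            have "exp (1::real) \<le> 3" using exp_le by simp
            then have "ln (exp 1) \<le> ln (real k)" using k3 by (intro ln_mono) auto
            then show ?thesis by simp
          qed
          then have "0 \<le> q" by (simp add: q_def)
          then have "sqrt (2 * \<theta>) * q \<le> \<delta> / 2 * q" using sq by (rule mult_right_mono[rotated])
          then have "(\<Sum>i<k. log_sum s (\<omega> i)) + sqrt (2 * \<theta>) * q \<le> - (\<delta> / 2) * q"
            using S by (simp add: q_def)
          then show ?thesis unfolding exp_add[symmetric] by (intro mult_left_mono) auto
        qed
        finally show ?thesis by (simp add: G_def t_def q_def)
      qed
      show ?case
      proof (rule hausdorff_measure_attractor_eq_0[OF \<omega> D(2)])
        show "h1_gauge s \<beta> \<epsilon> r0 0 = 0" by (simp add: h1_gauge_def)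
        show "h1_gauge s \<beta> \<epsilon> r0 x \<le> h1_gauge s \<beta> \<epsilon> r0 y" if "0 \<le> x" "x \<le> y" for x y
          using that by (rule h1_gauge_mono[OF adm])
        fix e :: real assume "0 < e"
        then have "\<forall>\<^sub>F k in sequentially. G k < e" using G by (intro order_tendstoD)
        then have "\<forall>\<^sub>F k in sequentially. G k < e \<and> D * scale \<omega> k < r0 \<and> 3 \<le> k"
          using small eventually_ge_at_top[of 3] by eventually_elim simp
        then show "\<exists>\<^sub>F k in sequentially. real (card (words \<omega> k)) * h1_gauge s \<beta> \<epsilon> r0 (D * scale \<omega> k) \<le> e"
        proof (intro frequently_rev_mp[OF elim(1)], eventually_elim)
          case (elim k)
          then show ?case using bound[of k] by linarith
        qed
      qed
    qed
  qed
qed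

end

theorem theorem3p3:
  fixes \<Lambda> :: "(real ^ 'k) set"
    and \<mu> :: "(real ^ 'k) measure"
    and N :: "real ^ 'k \<Rightarrow> nat"
    and f :: "real ^ 'k \<Rightarrow> nat \<Rightarrow> real ^ 'd \<Rightarrow> real ^ 'd"
    and c :: "real ^ 'k \<Rightarrow> nat \<Rightarrow> real"
    and \<Delta> :: "(real ^ 'd) set"
    and cmin cmax s \<epsilon> :: real
  assumes "rifs \<mu> \<Lambda> N f c \<Delta>"
    and "UOSC \<Lambda> N f"
    and "bdd_above (N ` \<Lambda>)" and "2 \<le> (SUP l\<in>\<Lambda>. N l)"
    and "0 < prob_space.expectation (PH \<mu>) (\<lambda>\<omega>. ln (real (N (\<omega> 0))))"
    and "0 < cmin" and "cmin \<le> cmax" and "cmax < 1"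
    and "\<forall>l\<in>\<Lambda>. \<exists>cl\<in>{cmin..cmax}. \<forall>i\<in>{1..N l}. c l i = cl"
    and "\<not> almost_deterministic \<mu> N c"
    and "AE \<omega> in PH \<mu>. hausdorff_dim (attractor N f \<Delta> \<omega>) = s"
    and "0 < \<epsilon>"
  shows "\<exists>\<eta>>0. \<exists>\<beta>.
     \<beta> = prob_space.variance (PH \<mu>) (\<lambda>\<omega>. ln (ratio_sum N c (\<omega> 0) s)) / \<eta> \<and>
     (\<exists>r0. h1_admissible s \<beta> \<epsilon> r0) \<and>
     (\<forall>r0. h1_admissible s \<beta> \<epsilon> r0 \<longrightarrow>
        (AE \<omega> in PH \<mu>. hausdorff_measure (h1_gauge s \<beta> \<epsilon> r0) (attractor N f \<Delta> \<omega>) = 0))"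
proof -
  interpret rifs \<mu> \<Lambda> N f c \<Delta> by (rule assms(1))
  have const: "c l i = c l 1 \<and> c l 1 \<in> {cmin..cmax}" if "l \<in> \<Lambda>" "i \<in> {1..N l}" for l i
  proof -
    have "1 \<in> {1..N l}" using N_ge_1[OF that(1)] by simp
    then show ?thesis using assms(9) that by fastforce
  qed
  interpret bounded_homogeneous_rifs \<mu> \<Lambda> N f c \<Delta> cmin cmax
  proof unfold_locales
    show "c l 1 \<in> {cmin..cmax}" if "l \<in> \<Lambda>" for l
      using const[OF that, of 1] N_ge_1[OF that] by simp
    show "c l i = c l 1" if "l \<in> \<Lambda>" "i \<in> {1..N l}" for l i
      using const[OF that] by simp
  qed (fact assms)+
  obtain B where "bounded_iid \<mu> (log_sum s) B" using log_sum_bounded_iid by blast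
  then interpret L: bounded_iid \<mu> "log_sum s" B .
  have p0: "pressure 0 = prob_space.expectation (PH \<mu>) (\<lambda>\<omega>. ln (real (N (\<omega> 0))))"
    using L.expectation_coord[of "log_sum 0" 0] borel_measurable_integrable[OF integrable_log_sum[of 0]]
    by (simp add: pressure_def log_sum_def)
  have s: "0 < s" "pressure s = 0"
    using dimension_zero_of_pressure[OF assms(2) _ assms(11)] assms(5) p0 by auto
  define V where "V = variance (log_sum s)"
  have V: "0 < V" unfolding V_def by (rule variance_log_sum_pos) fact+
  \<comment> \<open>Applied to the identity and to the squared deviation, this carries mean and
    variance from the product space to \<open>\<mu>\<close>.\<close>
  have cong: "L.PH.expectation (\<lambda>\<omega>. h (ln (ratio_sum N c (\<omega> 0) s))) = expectation (\<lambda>l. h (log_sum s l))"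
    if [measurable]: "h \<in> borel_measurable borel" for h :: "real \<Rightarrow> real"
  proof -
    have "L.PH.expectation (\<lambda>\<omega>. h (ln (ratio_sum N c (\<omega> 0) s))) = L.PH.expectation (\<lambda>\<omega>. h (log_sum s (\<omega> 0)))"
      by (intro Bochner_Integration.integral_cong refl) (simp add: ln_ratio_sum PH_in_Lambda)
    also have "\<dots> = expectation (\<lambda>l. h (log_sum s l))"
      by (rule L.expectation_coord) measurable
    finally show ?thesis .
  qed
  have var: "prob_space.variance (PH \<mu>) (\<lambda>\<omega>. ln (ratio_sum N c (\<omega> 0) s)) = V"
    unfolding V_def using cong[of "\<lambda>x. x"] cong[of "\<lambda>x. (x - expectation (log_sum s))\<^sup>2"] by simp
  obtain \<beta> where \<beta>: "0 < \<beta>" "\<And>r0. h1_admissible s \<beta> \<epsilon> r0 \<Longrightarrow>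
      AE \<omega> in PH \<mu>. hausdorff_measure (h1_gauge s \<beta> \<epsilon> r0) (attractor N f \<Delta> \<omega>) = 0"
    using AE_gauge_measure_zero[OF s V[unfolded V_def], of \<epsilon>] assms(12) by auto
  show ?thesis
  \<comment> \<open>\<eta> is the variance divided by a sufficiently small \<beta>, so that the
    prescribed quotient returns this very \<beta>.\<close>
  proof (rule exI[of _ "V / \<beta>"], rule conjI, goal_cases)
    case 2
    show ?case
    proof (rule exI[of _ \<beta>], intro conjI allI impI)
      show "\<beta> = prob_space.variance (PH \<mu>) (\<lambda>\<omega>. ln (ratio_sum N c (\<omega> 0) s)) / (V / \<beta>)"
        unfolding var using V \<beta> by simp
      show "\<exists>r0. h1_admissible s \<beta> \<epsilon> r0" by (rule h1_admissible_exists[OF s(1) \<beta>(1)])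
    qed (rule \<beta>(2))
  qed (use V \<beta> in simp)
qed

end
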